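(* There are universal constants $c,C>0$ such that the following holds. Let $(\Pi,\mathcal F)$ be a measurable class of simulatable causal policies with prior probability measure $\nu$, satisfying the measurability and integrability conditions stated in the context. Let $K_0$ satisfy $\Lambda(K_0)<\infty$, and run Gibbs counterfactual tracking with prior $\nu$, learning rate $\eta>0$ and tracking gain $K_0$, with $e_1=x_1-\bar x_1=0$. Assume $$\sup_{t\le T}\sup_{\pi,\pi'\in\Pi}\|y_t^\pi-y_t^{\pi'}\|\le\Delta,$$ and that for every $t$ the cost $c_t$ is convex and $L$-Lipschitz on the convex hull of the physical point $y_t$ and the essential range (with respect to $\nu$) of $\{y_t^\pi:\pi\in\Pi\}$. If $\eta L\Delta\le c$, then simultaneously for every probability measure $\rho\ll\nu$ on $\Pi$, $$\sum_{t=1}^T c_t(y_t)-\mathbb E_{\pi\sim\rho}\sum_{t=1}^T c_t(y_t^\pi)\le\frac{\mathrm{KL}(\rho\|\nu)}{\eta}+C\eta L^2\Delta^2\Gamma_{\rm tr}T.$$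
   Context: Model: $A\in\mathbb R^{d_x\times d_x}$, $B\in\mathbb R^{d_x\times d_u}$ are known; $x_1=0$ and $x_{t+1}=Ax_t+Bu_t+w_t$ with $\|w_t\|\le W$. On round $t=1,\dots,T$ the learner observes $x_t$, chooses $u_t$, incurs $c_t(x_t,u_t)$, then observes the whole function $c_t$ and $x_{t+1}$ (hence $w_t$). The environment may choose $c_t,w_t$ as a function of previously revealed history but not of the current action. The bound is pathwise (for the realized sequence). Write $y_t=(x_t,u_t)$. Policies: a causal policy $\pi$ chooses its action from its own state and the previously revealed costs and disturbances (any random seed is part of its description). Its counterfactual trajectory $y_t^\pi=(x_t^\pi,u_t^\pi)$ is obtained by running $\pi$ from $x_1^\pi=0$ on the same realized $(c_t,w_t)$: $x_{t+1}^\pi=Ax_t^\pi+Bu_t^\pi+w_t$. It is simulatable: after round $t$ its next state and its round-$(t+1)$ action can be computed from the revealed history. Measurability/integrability conditions: $(\Pi,\mathcal F)$ is a standard Borel space with prior $\nu$, the maps $\pi\mapsto y_t^\pi$ and $\pi\mapsto c_t(y_t^\pi)$ are measurable, and the vector-valued integrals below exist. Gibbs counterfactual tracking: $$p_t(d\pi)=\frac{\exp\{-\eta\sum_{s<t}c_s(y_s^\pi)\}\,\nu(d\pi)}{\int\exp\{-\eta\sum_{s<t}c_s(y_s^{\pi'})\}\,\nu(d\pi')},\qquad \bar y_t=(\bar x_t,\bar u_t)=\int y_t^\pi\,p_t(d\pi),$$ and the physical action is $u_t=\bar u_t-K_0(x_t-\bar x_t)$. Norms: $\|\cdot\|$ Euclidean,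 $\|(x,u)\|^2=\|x\|^2+\|u\|^2$. With $F_0=A-BK_0$: $\Lambda(K_0)=\sum_{r\ge0}\left\|\begin{bmatrix}I\\-K_0\end{bmatrix}F_0^r\right\|_{\rm op}$, $B_+=\|[A\ B]\|_{\rm op}$, $\Gamma_{\rm tr}=1+\Lambda(K_0)B_+$. $\mathrm{KL}(\rho\|\nu)$ is relative entropy (possibly $+\infty$). *)

theory Defs
  imports "HOL-Probability.Probability" "Jordan_Normal_Form.Matrix"
begin

no_notation vec_nth (infixl \<open>$\<close> 90)
no_notation inner (infix \<open>\<bullet>\<close> 70)
hide_const (open) Finite_Cartesian_Product.vec Cartesian_Space.vector
  Finite_Cartesian_Product.mat Finite_Cartesian_Product.row Finite_Cartesian_Product.column

text \<open>
  The constants in the theorem have to be independent of the dimensions, so the dimensions are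
  natural numbers quantified inside the formula, and \<open>\<real>\<^sup>n\<close> is \<^term>\<open>carrier_vec n :: real vec set\<close>.
  A state-action pair \<open>y = (x, u)\<close> is the concatenation \<open>x @\<^sub>v u\<close>, whose Euclidean norm
  satisfies \<open>\<parallel>(x, u)\<parallel>\<^sup>2 = \<parallel>x\<parallel>\<^sup>2 + \<parallel>u\<parallel>\<^sup>2\<close>.
\<close>

section \<open>Euclidean geometry on \<open>carrier_vec n\<close>\<close>

definition enorm :: "real vec \<Rightarrow> real" where
  "enorm v = L2_set (\<lambda>i. v $ i) {..<dim_vec v}"

definition opnorm :: "real mat \<Rightarrow> real" where
  "opnorm M = (SUP v \<in> {v \<in> carrier_vec (dim_col M). enorm v \<le> 1}. enorm (M *\<^sub>v v))"

text \<open>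
  The next four definitions repeat the library's \<^const>\<open>convex\<close>, \<open>convex hull\<close>, \<^const>\<open>convex_on\<close>
  and \<^const>\<open>lipschitz_on\<close>, which are not available because \<^typ>\<open>real vec\<close>, containing vectors
  of all dimensions, is not a vector space.
\<close>

definition vec_convex :: "real vec set \<Rightarrow> bool" where
  "vec_convex S \<longleftrightarrow> (\<forall>x\<in>S. \<forall>y\<in>S. \<forall>a\<ge>0. \<forall>b\<ge>0. a + b = 1 \<longrightarrow> a \<cdot>\<^sub>v x + b \<cdot>\<^sub>v y \<in> S)"

definition vec_convex_hull :: "real vec set \<Rightarrow> real vec set" where
  "vec_convex_hull S = vec_convex hull S"

definition vec_convex_on :: "real vec set \<Rightarrow> (real vec \<Rightarrow> real) \<Rightarrow> bool" where
  "vec_convex_on S f \<longleftrightarrow> vec_convex S \<and>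
     (\<forall>x\<in>S. \<forall>y\<in>S. \<forall>a\<ge>0. \<forall>b\<ge>0. a + b = 1 \<longrightarrow> f (a \<cdot>\<^sub>v x + b \<cdot>\<^sub>v y) \<le> a * f x + b * f y)"

definition vec_lipschitz_on :: "real \<Rightarrow> real vec set \<Rightarrow> (real vec \<Rightarrow> real) \<Rightarrow> bool" where
  "vec_lipschitz_on L S f \<longleftrightarrow> 0 \<le> L \<and> (\<forall>x\<in>S. \<forall>y\<in>S. \<bar>f x - f y\<bar> \<le> L * enorm (x - y))"

section \<open>Measure and integration of vector-valued maps\<close>

definition vec_measurable :: "nat \<Rightarrow> 'p measure \<Rightarrow> ('p \<Rightarrow> real vec) \<Rightarrow> bool" where
  "vec_measurable n M f \<longleftrightarrow> (\<forall>i<n. (\<lambda>\<pi>. f \<pi> $ i) \<in> borel_measurable M)"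

definition vec_integrable :: "nat \<Rightarrow> 'p measure \<Rightarrow> ('p \<Rightarrow> real vec) \<Rightarrow> bool" where
  "vec_integrable n M f \<longleftrightarrow> (\<forall>i<n. integrable M (\<lambda>\<pi>. f \<pi> $ i))"

definition vec_integral :: "nat \<Rightarrow> 'p measure \<Rightarrow> ('p \<Rightarrow> real vec) \<Rightarrow> real vec" where
  "vec_integral n M f = vec n (\<lambda>i. \<integral>\<pi>. f \<pi> $ i \<partial>M)"

definition ess_range :: "nat \<Rightarrow> 'p measure \<Rightarrow> ('p \<Rightarrow> real vec) \<Rightarrow> real vec set" where
  "ess_range n M f =
     {z \<in> carrier_vec n. \<forall>\<epsilon>>0. 0 < emeasure M {\<pi> \<in> space M. enorm (f \<pi> - z) < \<epsilon>}}"

definition standard_borel_space :: "'p measure \<Rightarrow> bool" where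
  "standard_borel_space M \<longleftrightarrow>
     (\<exists>X. topspace X = space M \<and> completely_metrizable_space X \<and> second_countable X \<and>
          sets M = sigma_sets (space M) {U. openin X U})"

text \<open>
  Relative entropy \<open>KL(\<rho> \<parallel> \<nu>)\<close>. The negative part of the log-density is always \<open>\<rho>\<close>-integrable, so
  failure of integrability means that the integral is \<open>+\<infinity>\<close>; the library's real-valued
  \<^const>\<open>KL_divergence\<close> would return \<open>0\<close> there.
\<close>

definition relative_entropy :: "'p measure \<Rightarrow> 'p measure \<Rightarrow> ereal" where
  "relative_entropy \<rho> \<nu> =
     (if absolutely_continuous \<nu> \<rho> \<and> integrable \<rho> (entropy_density (exp 1) \<nu> \<rho>)
      then ereal (KL_divergence (exp 1) \<nu> \<rho>) else \<infinity>)"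

section \<open>Policies and their counterfactual trajectories\<close>

text \<open>
  A policy consists of a seed and a decision rule that maps the seed, the policy's own state at
  round \<open>t\<close>, the costs \<open>c\<^sub>1, \<dots>, c\<^bsub>t-1\<^esub>\<close> and the disturbances \<open>w\<^sub>1, \<dots>, w\<^bsub>t-1\<^esub>\<close> to the action at
  round \<open>t\<close>. The fixed type keeps the constants in the theorem independent of the policy class.
  Real seeds lose no generality: a standard Borel space has at most the cardinality of the
  continuum, so every element of a class can be tagged by a real number of its own.
\<close>

type_synonym cost = "real vec \<Rightarrow> real"

datatype policy =
  Policy (seed: real) (rule: "real \<Rightarrow> real vec \<Rightarrow> cost list \<Rightarrow> real vec list \<Rightarrow> real vec")

definition act :: "policy \<Rightarrow> real vec \<Rightarrow> cost list \<Rightarrow> real vec list \<Rightarrow> real vec" where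
  "act \<pi> = rule \<pi> (seed \<pi>)"

definition causal_policy :: "nat \<Rightarrow> nat \<Rightarrow> policy \<Rightarrow> bool" where
  "causal_policy dx du \<pi> \<longleftrightarrow>
     (\<forall>x cs ws. x \<in> carrier_vec dx \<longrightarrow> set ws \<subseteq> carrier_vec dx \<longrightarrow> length cs = length ws \<longrightarrow>
        act \<pi> x cs ws \<in> carrier_vec du)"

text \<open>Rounds are numbered from \<open>1\<close>; the values at index \<open>0\<close> below are dummies.\<close>

definition revealed :: "(nat \<Rightarrow> 'b) \<Rightarrow> nat \<Rightarrow> 'b list" where
  "revealed f t = map f [1..<t]"

primrec cf_state ::
  "real mat \<Rightarrow> real mat \<Rightarrow> (nat \<Rightarrow> cost) \<Rightarrow> (nat \<Rightarrow> real vec) \<Rightarrow> nat \<Rightarrow> policy \<Rightarrow> real vec" where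
  "cf_state A B c w 0 \<pi> = 0\<^sub>v (dim_row A)"
| "cf_state A B c w (Suc t) \<pi> =
     (if t = 0 then 0\<^sub>v (dim_row A)
      else A *\<^sub>v cf_state A B c w t \<pi>
         + B *\<^sub>v act \<pi> (cf_state A B c w t \<pi>) (revealed c t) (revealed w t) + w t)"

definition cf_action ::
  "real mat \<Rightarrow> real mat \<Rightarrow> (nat \<Rightarrow> cost) \<Rightarrow> (nat \<Rightarrow> real vec) \<Rightarrow> nat \<Rightarrow> policy \<Rightarrow> real vec" where
  "cf_action A B c w t \<pi> = act \<pi> (cf_state A B c w t \<pi>) (revealed c t) (revealed w t)"

definition cf_point ::
  "real mat \<Rightarrow> real mat \<Rightarrow> (nat \<Rightarrow> cost) \<Rightarrow> (nat \<Rightarrow> real vec) \<Rightarrow> nat \<Rightarrow> policy \<Rightarrow> real vec" where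
  "cf_point A B c w t \<pi> = cf_state A B c w t \<pi> @\<^sub>v cf_action A B c w t \<pi>"

section \<open>Gibbs counterfactual tracking\<close>

definition gibbs_weight ::
  "real mat \<Rightarrow> real mat \<Rightarrow> (nat \<Rightarrow> cost) \<Rightarrow> (nat \<Rightarrow> real vec) \<Rightarrow> real \<Rightarrow> nat \<Rightarrow> policy \<Rightarrow> real" where
  "gibbs_weight A B c w \<eta> t \<pi> = exp (- \<eta> * (\<Sum>s\<in>{1..<t}. c s (cf_point A B c w s \<pi>)))"

definition gibbs ::
  "real mat \<Rightarrow> real mat \<Rightarrow> (nat \<Rightarrow> cost) \<Rightarrow> (nat \<Rightarrow> real vec) \<Rightarrow> real \<Rightarrow> policy measure \<Rightarrow> nat \<Rightarrow>
     policy measure" where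
  "gibbs A B c w \<eta> \<nu> t =
     density \<nu> (\<lambda>\<pi>. ennreal (gibbs_weight A B c w \<eta> t \<pi> /
                             (\<integral>\<pi>'. gibbs_weight A B c w \<eta> t \<pi>' \<partial>\<nu>)))"

definition mean_state ::
  "real mat \<Rightarrow> real mat \<Rightarrow> (nat \<Rightarrow> cost) \<Rightarrow> (nat \<Rightarrow> real vec) \<Rightarrow> real \<Rightarrow> policy measure \<Rightarrow> nat \<Rightarrow>
     real vec" where
  "mean_state A B c w \<eta> \<nu> t = vec_integral (dim_row A) (gibbs A B c w \<eta> \<nu> t) (cf_state A B c w t)"

definition mean_action ::
  "real mat \<Rightarrow> real mat \<Rightarrow> (nat \<Rightarrow> cost) \<Rightarrow> (nat \<Rightarrow> real vec) \<Rightarrow> real \<Rightarrow> policy measure \<Rightarrow> nat \<Rightarrow>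
     real vec" where
  "mean_action A B c w \<eta> \<nu> t = vec_integral (dim_col B) (gibbs A B c w \<eta> \<nu> t) (cf_action A B c w t)"

text \<open>\<open>tracking_block\<close> is the \<open>r\<close>-th summand matrix \<open>[I; -K\<^sub>0] F\<^sub>0\<^sup>r\<close> of \<open>\<Lambda>(K\<^sub>0)\<close>.\<close>

definition tracking_block :: "real mat \<Rightarrow> real mat \<Rightarrow> real mat \<Rightarrow> nat \<Rightarrow> real mat" where
  "tracking_block A B K0 r = (1\<^sub>m (dim_row A) @\<^sub>r (- K0)) * ((A - B * K0) ^\<^sub>m r)"

definition Lambda_finite :: "real mat \<Rightarrow> real mat \<Rightarrow> real mat \<Rightarrow> bool" where
  "Lambda_finite A B K0 \<longleftrightarrow> summable (\<lambda>r. opnorm (tracking_block A B K0 r))"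

definition Lambda :: "real mat \<Rightarrow> real mat \<Rightarrow> real mat \<Rightarrow> real" where
  "Lambda A B K0 = (\<Sum>r. opnorm (tracking_block A B K0 r))"

text \<open>The block row \<open>[A B]\<close>, written as a four-block matrix whose lower blocks have no rows.\<close>

definition B_plus :: "real mat \<Rightarrow> real mat \<Rightarrow> real" where
  "B_plus A B = opnorm (four_block_mat A B (0\<^sub>m 0 (dim_col A)) (0\<^sub>m 0 (dim_col B)))"

definition Gamma_tr :: "real mat \<Rightarrow> real mat \<Rightarrow> real mat \<Rightarrow> real" where
  "Gamma_tr A B K0 = 1 + Lambda A B K0 * B_plus A B"

end

theory Submission
  imports Defs
begin

text \<open>
  By Jensen's inequality and the Lipschitz bound, the cost at the physical point exceeds the Gibbs
  average of the counterfactual costs by at most \<open>L\<close> times the tracking gap, the distance from the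
  physical point to the Gibbs mean. The Gibbs averages telescope through
  \<open>E h \<le> - ln (E (exp (- h))) + 2 r\<^sup>2\<close>, valid for \<open>h\<close> within \<open>r \<le> 1/4\<close> of a constant, and the
  remaining log-partition function is compared with \<open>\<rho>\<close> by the Donsker--Varadhan inequality. One
  Gibbs update multiplies the density by a factor within \<open>4 \<eta> L \<Delta>\<close> of \<open>1\<close>, so it moves the mean
  point by at most \<open>4 \<eta> L \<Delta>\<^sup>2\<close>; the tracking error is driven by these displacements alone, because
  the disturbances cancel, and the linear feedback amplifies them by at most \<open>\<Lambda>(K\<^sub>0) B\<^sub>+\<close>.
\<close>

section \<open>Euclidean and operator norms\<close>

text \<open>The cost conditions say nothing outside the hull of the physical point and the essential
  range, and they bound differences of costs, never costs. So estimates on losses hold almost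
  everywhere and are centred: it is enough that a loss is within \<open>L * \<Delta>\<close> of some
  constant, because adding a constant to \<open>h\<close> changes neither the Gibbs law nor the
  difference between \<open>E h\<close> and \<open>- ln (E (exp (- h)))\<close>. Everything then
  depends on \<open>r = \<eta> * L * \<Delta>\<close>. The threshold 1/4 comes from the density
  ratio, which involves \<open>exp (2 * r)\<close> and is bounded linearly for
  \<open>2 * r \<le> 1/2\<close>. After multiplication by \<open>\<eta>\<close>, a round costs
  \<open>2 * r\<^sup>2\<close> in the log-partition step and \<open>4 * r\<^sup>2\<close> times
  \<open>\<Lambda>(K\<^sub>0) B\<^sub>+\<close> through the tracking gap. Rounding 2 up to 4
  collects both into \<open>4 * r\<^sup>2\<close> times \<open>Gamma_tr\<close>; division by
  \<open>\<eta>\<close> then gives \<open>C = 4\<close>. No constant may depend on a dimension. The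
  shift of the Gibbs mean is therefore bounded by pairing it with itself instead of coordinate by
  coordinate, whereas the dimension-dependent grid error in Jensen's inequality is harmless, since
  the mesh is arbitrary.\<close>

lemma enorm_nonneg [simp]: "0 \<le> enorm v"
  by (simp add: enorm_def)

lemma enorm_carrier: "v \<in> carrier_vec n \<Longrightarrow> enorm v = L2_set (\<lambda>i. v $ i) {..<n}"
  by (auto simp: enorm_def)

lemma enorm_zero [simp]: "enorm (0\<^sub>v n) = 0"
  by (simp add: enorm_def L2_set_def)

lemma enorm_triangle:
  assumes "v \<in> carrier_vec n" "w \<in> carrier_vec n"
  shows "enorm (v + w) \<le> enorm v + enorm w"
proof -
  have "enorm (v + w) = L2_set (\<lambda>i. v $ i + w $ i) {..<n}"
    using assms by (auto simp: enorm_def intro!: L2_set_cong)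
  also have "\<dots> \<le> enorm v + enorm w"
    using assms L2_set_triangle_ineq[of "\<lambda>i. v $ i" "\<lambda>i. w $ i" "{..<n}"]
    by (simp add: enorm_carrier[of _ n])
  finally show ?thesis .
qed

lemma enorm_smult: "enorm (a \<cdot>\<^sub>v v) = \<bar>a\<bar> * enorm v"
proof -
  have "enorm (a \<cdot>\<^sub>v v) = L2_set (\<lambda>i. a * v $ i) {..<dim_vec v}"
    by (auto simp: enorm_def intro!: L2_set_cong)
  also have "\<dots> = \<bar>a\<bar> * enorm v"
    by (simp add: enorm_def L2_set_def power_mult_distrib real_sqrt_mult flip: sum_distrib_left)
  finally show ?thesis .
qed

lemma enorm_minus_commute:
  assumes "v \<in> carrier_vec n" "w \<in> carrier_vec n"
  shows "enorm (v - w) = enorm (w - v)"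
  using assms by (auto simp: enorm_def L2_set_def power2_commute)

lemma enorm_diff_triangle:
  assumes "u \<in> carrier_vec n" "v \<in> carrier_vec n" "w \<in> carrier_vec n"
  shows "enorm (u - w) \<le> enorm (u - v) + enorm (v - w)"
proof -
  have "u - w = (u - v) + (v - w)"
    using assms by (intro eq_vecI) auto
  then show ?thesis
    using enorm_triangle[of "u - v" n "v - w"] assms by simp
qed

lemma abs_index_le_enorm: "i < dim_vec v \<Longrightarrow> \<bar>v $ i\<bar> \<le> enorm v"
  unfolding enorm_def using member_le_L2_set[of "{..<dim_vec v}" i "\<lambda>i. \<bar>v $ i\<bar>"]
  by (simp add: L2_set_def)

lemma enorm_le_sum: "enorm v \<le> (\<Sum>i<dim_vec v. \<bar>v $ i\<bar>)"
  unfolding enorm_def by (rule L2_set_le_sum_abs)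

lemma scalar_prod_self: "v \<bullet> v = (enorm v)\<^sup>2"
  by (simp add: enorm_def L2_set_def scalar_prod_def sum_nonneg power2_eq_square atLeast0LessThan)

text \<open>Cauchy--Schwarz; it is what makes the self-pairing bound on the shift of a mean free of
  the dimension.\<close>

lemma scalar_prod_le_enorm:
  assumes "v \<in> carrier_vec n" "w \<in> carrier_vec n"
  shows "v \<bullet> w \<le> enorm v * enorm w"
proof -
  have "v \<bullet> w \<le> (\<Sum>i<n. \<bar>v $ i\<bar> * \<bar>w $ i\<bar>)"
    using assms by (auto simp: scalar_prod_def atLeast0LessThan abs_mult[symmetric] intro!: sum_mono)
  also have "\<dots> \<le> enorm v * enorm w"
    using L2_set_mult_ineq[of "\<lambda>i. v $ i" "\<lambda>i. w $ i" "{..<n}"] assms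
    by (simp add: enorm_carrier[of _ n])
  finally show ?thesis .
qed

section \<open>Operator norm\<close>

text \<open>A real \<open>SUP\<close> is an upper bound only for a bounded set. On the unit ball
  every coordinate is at most 1 in absolute value, so the sum of the absolute entries is a crude
  bound.\<close>

lemma opnorm_bdd_above:
  "bdd_above ((\<lambda>v. enorm (M *\<^sub>v v)) ` {v \<in> carrier_vec (dim_col M). enorm v \<le> 1})"
proof (rule bdd_aboveI2)
  fix v assume v: "v \<in> {v \<in> carrier_vec (dim_col M). enorm v \<le> 1}"
  have "enorm (M *\<^sub>v v) \<le> (\<Sum>i<dim_row M. \<bar>row M i \<bullet> v\<bar>)"
    using enorm_le_sum[of "M *\<^sub>v v"] by simp
  also have "\<dots> \<le> (\<Sum>i<dim_row M. \<Sum>j<dim_col M. \<bar>M $$ (i, j)\<bar>)"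
  proof (rule sum_mono)
    fix i assume i: "i \<in> {..<dim_row M}"
    have "\<bar>row M i \<bullet> v\<bar> \<le> (\<Sum>j<dim_col M. \<bar>row M i $ j * v $ j\<bar>)"
      using v by (auto simp: scalar_prod_def atLeast0LessThan)
    also have "\<dots> \<le> (\<Sum>j<dim_col M. \<bar>M $$ (i, j)\<bar>)"
    proof (rule sum_mono)
      fix j assume j: "j \<in> {..<dim_col M}"
      have "\<bar>v $ j\<bar> \<le> 1"
        using v j abs_index_le_enorm[of j v] by auto
      then show "\<bar>row M i $ j * v $ j\<bar> \<le> \<bar>M $$ (i, j)\<bar>"
        using i j by (simp add: abs_mult mult_left_le)
    qed
    finally show "\<bar>row M i \<bullet> v\<bar> \<le> (\<Sum>j<dim_col M. \<bar>M $$ (i, j)\<bar>)" .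
  qed
  finally show "enorm (M *\<^sub>v v) \<le> (\<Sum>i<dim_row M. \<Sum>j<dim_col M. \<bar>M $$ (i, j)\<bar>)" .
qed

lemma enorm_mult_mat_vec_le_opnorm:
  "v \<in> carrier_vec (dim_col M) \<Longrightarrow> enorm v \<le> 1 \<Longrightarrow> enorm (M *\<^sub>v v) \<le> opnorm M"
  unfolding opnorm_def by (intro cSUP_upper opnorm_bdd_above) simp

lemma opnorm_nonneg: "0 \<le> opnorm M"
  using enorm_mult_mat_vec_le_opnorm[of "0\<^sub>v (dim_col M)" M] order_trans[OF enorm_nonneg] by force

lemma enorm_mult_mat_vec:
  assumes v: "v \<in> carrier_vec (dim_col M)"
  shows "enorm (M *\<^sub>v v) \<le> opnorm M * enorm v"
proof (cases "enorm v = 0")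
  case True
  have "\<And>i. i < dim_col M \<Longrightarrow> v $ i = 0"
    using True v abs_index_le_enorm[of _ v] by force
  then have "v = 0\<^sub>v (dim_col M)"
    using v by (intro eq_vecI) auto
  moreover have "M *\<^sub>v 0\<^sub>v (dim_col M) = 0\<^sub>v (dim_row M)"
    by (intro eq_vecI) auto
  ultimately show ?thesis by simp
next
  case False
  then have pos: "0 < enorm v" by (simp add: order_less_le)
  have "enorm (M *\<^sub>v ((1 / enorm v) \<cdot>\<^sub>v v)) \<le> opnorm M"
    by (rule enorm_mult_mat_vec_le_opnorm) (use v pos in \<open>auto simp: enorm_smult\<close>)
  moreover have "M *\<^sub>v ((1 / enorm v) \<cdot>\<^sub>v v) = (1 / enorm v) \<cdot>\<^sub>v (M *\<^sub>v v)"
    using v by (intro mult_mat_vec[of _ "dim_row M" "dim_col M"]) auto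
  ultimately show ?thesis
    using pos by (simp add: enorm_smult field_simps)
qed

section \<open>Essential range\<close>

lemma countable_rational_vecs: "countable {q :: real vec. q \<in> carrier_vec n \<and> (\<forall>i<n. q $ i \<in> \<rat>)}"
proof (rule countable_subset)
  show "{q :: real vec. q \<in> carrier_vec n \<and> (\<forall>i<n. q $ i \<in> \<rat>)} \<subseteq> vec_of_list ` lists \<rat>"
  proof
    fix q :: "real vec" assume q: "q \<in> {q. q \<in> carrier_vec n \<and> (\<forall>i<n. q $ i \<in> \<rat>)}"
    then have "list_of_vec q \<in> lists \<rat>"
      by (auto simp: in_set_conv_nth list_of_vec_index)
    then show "q \<in> vec_of_list ` lists \<rat>"
      by (metis image_eqI vec_list)
  qed
  show "countable (vec_of_list ` lists \<rat>)"
    by (simp add: countable_rat)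
qed

lemma rational_vec_dense:
  assumes z: "z \<in> carrier_vec n" and e: "0 < e"
  obtains q where "q \<in> carrier_vec n" "\<forall>i<n. q $ i \<in> \<rat>" "enorm (z - q) < e"
proof -
  \<comment> \<open>The \<open>+ 1\<close> makes the \<open>n\<close> coordinate errors add up to
    strictly less than \<open>e\<close> and keeps the denominator positive for
    \<open>n = 0\<close>.\<close>
  have "\<forall>i. \<exists>r\<in>\<rat>. z $ i < r \<and> r < z $ i + e / (real n + 1)"
    using Rats_dense_in_real[of "z $ _" "z $ _ + e / (real n + 1)"] e by auto
  then obtain r where r: "\<And>i. r i \<in> \<rat>" "\<And>i. z $ i < r i" "\<And>i. r i < z $ i + e / (real n + 1)"
    by metis
  have "enorm (z - vec n r) \<le> (\<Sum>i<n. \<bar>z $ i - r i\<bar>)"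
    using enorm_le_sum[of "z - vec n r"] z by simp
  also have "\<dots> \<le> (\<Sum>i<n. e / (real n + 1))"
    using r by (intro sum_mono) (smt (verit))
  also have "\<dots> < e"
    using e by (simp add: field_simps)
  finally show thesis
    using r by (intro that[of "vec n r"]) auto
qed

lemma borel_measurable_enorm_diff:
  assumes f: "vec_measurable n M f" "\<And>x. x \<in> space M \<Longrightarrow> f x \<in> carrier_vec n"
    and z: "z \<in> carrier_vec n"
  shows "(\<lambda>x. enorm (f x - z)) \<in> borel_measurable M"
proof -
  have "(\<lambda>x. (f x $ i - z $ i)\<^sup>2) \<in> borel_measurable M" if "i < n" for i
    using f(1) that by (intro borel_measurable_power borel_measurable_diff) (auto simp: vec_measurable_def)
  then have "(\<lambda>x. \<Sum>i<n. (f x $ i - z $ i)\<^sup>2) \<in> borel_measurable M"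
    by (intro borel_measurable_sum) auto
  then have "(\<lambda>x. sqrt (\<Sum>i<n. (f x $ i - z $ i)\<^sup>2)) \<in> borel_measurable M"
    by (rule measurable_compose) simp
  then show ?thesis
    using f(2) z by (subst measurable_cong) (auto simp: enorm_def L2_set_def)
qed

text \<open>A Lindelof argument. A value outside the essential range is the centre of a ball with
  null preimage; that ball contains a smaller one, with rational centre and radius
  \<open>1 / (k + 1)\<close>, which still contains the value. Only countably many such balls exist,
  so the exceptional set is null.\<close>

lemma AE_in_ess_range:
  assumes f: "vec_measurable n M f" "\<And>x. x \<in> space M \<Longrightarrow> f x \<in> carrier_vec n"
  shows "AE x in M. f x \<in> ess_range n M f"
proof -
  define Q where "Q = {q :: real vec. q \<in> carrier_vec n \<and> (\<forall>i<n. q $ i \<in> \<rat>)}"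
  define E where "E z e = {x \<in> space M. enorm (f x - z) < e}" for z e
  have E_sets: "E z e \<in> sets M" if "z \<in> carrier_vec n" for z e
    unfolding E_def using borel_measurable_enorm_diff[OF f that] by measurable
  have "AE x in M. \<forall>qk\<in>Q \<times> (UNIV :: nat set). emeasure M (E (fst qk) (1 / (real (snd qk) + 1))) = 0 \<longrightarrow>
      x \<notin> E (fst qk) (1 / (real (snd qk) + 1))"
  proof (subst AE_ball_countable)
    show "countable (Q \<times> (UNIV :: nat set))"
      unfolding Q_def using countable_rational_vecs by auto
    show "\<forall>qk\<in>Q \<times> (UNIV :: nat set). AE x in M. emeasure M (E (fst qk) (1 / (real (snd qk) + 1))) = 0 \<longrightarrow>
        x \<notin> E (fst qk) (1 / (real (snd qk) + 1))"
    proof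
      fix qk :: "real vec \<times> nat" assume "qk \<in> Q \<times> UNIV"
      then have "E (fst qk) (1 / (real (snd qk) + 1)) \<in> sets M"
        by (intro E_sets) (auto simp: Q_def)
      then show "AE x in M. emeasure M (E (fst qk) (1 / (real (snd qk) + 1))) = 0 \<longrightarrow>
          x \<notin> E (fst qk) (1 / (real (snd qk) + 1))"
        using AE_not_in[of "E (fst qk) (1 / (real (snd qk) + 1))" M]
        by (cases "emeasure M (E (fst qk) (1 / (real (snd qk) + 1))) = 0") (auto simp: null_sets_def)
    qed
  qed
  then show ?thesis
  proof (rule AE_mp[OF _ AE_I2], intro impI)
    fix x assume x: "x \<in> space M" and null: "\<forall>qk\<in>Q \<times> (UNIV :: nat set).
      emeasure M (E (fst qk) (1 / (real (snd qk) + 1))) = 0 \<longrightarrow> x \<notin> E (fst qk) (1 / (real (snd qk) + 1))"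
    show "f x \<in> ess_range n M f"
    proof (rule ccontr)
      assume "f x \<notin> ess_range n M f"
      then obtain e where e: "0 < e" "emeasure M (E (f x) e) = 0"
        using f(2)[OF x] by (auto simp: ess_range_def E_def not_less)
      \<comment> \<open>Half of \<open>e\<close>, because two points of the rational ball can be
        twice its radius apart.\<close>
      obtain k :: nat where k: "1 / (real k + 1) < e / 2"
        using nat_approx_posE[of "e / 2"] e(1) by (metis half_gt_zero add.commute of_nat_Suc)
      obtain q where q: "q \<in> carrier_vec n" "\<forall>i<n. q $ i \<in> \<rat>" "enorm (f x - q) < 1 / (real k + 1)"
        using rational_vec_dense[OF f(2)[OF x], of "1 / (real k + 1)"] by force
      have "E q (1 / (real k + 1)) \<subseteq> E (f x) e"
      proof
        fix y assume y: "y \<in> E q (1 / (real k + 1))"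
        then have "enorm (f y - f x) \<le> enorm (f y - q) + enorm (f x - q)"
          using enorm_diff_triangle[of "f y" n q "f x"] f(2) x q(1) enorm_minus_commute[of q n "f x"]
          by (auto simp: E_def)
        then show "y \<in> E (f x) e"
          using y q(3) k by (auto simp: E_def)
      qed
      then have "emeasure M (E q (1 / (real k + 1))) \<le> emeasure M (E (f x) e)"
        by (intro emeasure_mono E_sets f(2) x)
      then have "x \<notin> E q (1 / (real k + 1))"
        using null[rule_format, of "(q, k)"] q e(2) by (auto simp: Q_def add.commute)
      then show False
        using q(3) x by (simp add: E_def)
    qed
  qed
qed

section \<open>Exponential tilting\<close>

text \<open>Losses are controlled only where the counterfactual point is in the essential range, so
  boundedness has to be almost everywhere. The notion survives sums, exponentials and passage to an
  absolutely continuous measure, and gives integrability under every finite measure.\<close>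

definition ess_bounded :: "'a measure \<Rightarrow> ('a \<Rightarrow> real) \<Rightarrow> bool" where
  "ess_bounded M h \<longleftrightarrow> h \<in> borel_measurable M \<and> (\<exists>b. AE x in M. \<bar>h x\<bar> \<le> b)"

lemma ess_boundedD: "ess_bounded M h \<Longrightarrow> h \<in> borel_measurable M"
  by (simp add: ess_bounded_def)

lemma ess_bounded_const: "ess_bounded M (\<lambda>x. k)"
  by (auto simp: ess_bounded_def)

lemma ess_bounded_add:
  assumes "ess_bounded M g" "ess_bounded M h"
  shows "ess_bounded M (\<lambda>x. g x + h x)"
proof -
  obtain b b' where "AE x in M. \<bar>g x\<bar> \<le> b" "AE x in M. \<bar>h x\<bar> \<le> b'"
    using assms by (auto simp: ess_bounded_def)
  then have "AE x in M. \<bar>g x + h x\<bar> \<le> b + b'" by eventually_elim simp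
  then show ?thesis using assms by (auto simp: ess_bounded_def)
qed

lemma ess_bounded_cmult:
  assumes "ess_bounded M h"
  shows "ess_bounded M (\<lambda>x. k * h x)"
proof -
  obtain b where "AE x in M. \<bar>h x\<bar> \<le> b"
    using assms by (auto simp: ess_bounded_def)
  then have "AE x in M. \<bar>k * h x\<bar> \<le> \<bar>k\<bar> * b" by eventually_elim (simp add: abs_mult mult_left_mono)
  then show ?thesis using assms by (auto simp: ess_bounded_def)
qed

lemma ess_bounded_sum:
  assumes "\<And>i. i \<in> I \<Longrightarrow> ess_bounded M (h i)"
  shows "ess_bounded M (\<lambda>x. \<Sum>i\<in>I. h i x)"
  using assms by (induction I rule: infinite_finite_induct) (auto intro: ess_bounded_const ess_bounded_add)

lemma ess_bounded_exp:
  assumes "ess_bounded M h"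
  shows "ess_bounded M (\<lambda>x. exp (h x))"
proof -
  obtain b where "AE x in M. \<bar>h x\<bar> \<le> b"
    using assms by (auto simp: ess_bounded_def)
  then have "AE x in M. \<bar>exp (h x)\<bar> \<le> exp b" by eventually_elim simp
  moreover have [measurable]: "h \<in> borel_measurable M"
    using assms by (simp add: ess_bounded_def)
  have "(\<lambda>x. exp (h x)) \<in> borel_measurable M"
    by measurable
  ultimately show ?thesis unfolding ess_bounded_def by blast
qed

lemma ess_bounded_exp_minus: "ess_bounded M h \<Longrightarrow> ess_bounded M (\<lambda>x. exp (- h x))"
  using ess_bounded_exp[OF ess_bounded_cmult[of M h "-1"]] by simp

lemma ess_bounded_absolutely_continuous:
  assumes "ess_bounded M h" "sets N = sets M" "absolutely_continuous M N"
  shows "ess_bounded N h"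
  using assms absolutely_continuous_AE[of N M]
  by (auto simp: ess_bounded_def cong: measurable_cong_sets)

lemma (in finite_measure) integrable_ess_bounded: "ess_bounded M h \<Longrightarrow> integrable M h"
  unfolding ess_bounded_def by (auto intro: integrable_const_bound[where f = h, simplified])

text \<open>The exponential change of measure. Both the Gibbs law of a round, relative to the prior,
  and the update from one round to the next are of this form.\<close>

definition tilt :: "'a measure \<Rightarrow> ('a \<Rightarrow> real) \<Rightarrow> 'a measure" where
  "tilt M h = density M (\<lambda>x. ennreal (exp (- h x) / (\<integral>y. exp (- h y) \<partial>M)))"

lemma space_tilt [simp]: "space (tilt M h) = space M"
  and sets_tilt [simp, measurable_cong]: "sets (tilt M h) = sets M"
  by (simp_all add: tilt_def)

lemma AE_tilt:
  assumes "h \<in> borel_measurable M" "AE x in M. P x"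
  shows "AE x in tilt M h. P x"
  unfolding tilt_def using assms by (subst AE_density) auto

lemma (in prob_space) integral_exp_pos:
  assumes "ess_bounded M h"
  shows "0 < (\<integral>x. exp (h x) \<partial>M)"
proof -
  obtain b where b: "AE x in M. \<bar>h x\<bar> \<le> b"
    using assms by (auto simp: ess_bounded_def)
  have "(\<integral>x. exp (- b) \<partial>M) \<le> (\<integral>x. exp (h x) \<partial>M)"
  proof (rule integral_mono_AE)
    show "AE x in M. exp (- b) \<le> exp (h x)" using b by eventually_elim simp
  qed (use assms in \<open>auto intro: integrable_ess_bounded ess_bounded_exp\<close>)
  then show ?thesis by (simp add: prob_space less_le_trans[OF exp_gt_zero])
qed

lemma (in prob_space) integral_exp_minus_pos: "ess_bounded M h \<Longrightarrow> 0 < (\<integral>x. exp (- h x) \<partial>M)"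
  using integral_exp_pos[OF ess_bounded_cmult[of M h "-1"]] by simp

lemma (in prob_space) integral_tilt:
  fixes g :: "'a \<Rightarrow> real"
  assumes h: "ess_bounded M h" and g: "g \<in> borel_measurable M"
  shows "(\<integral>x. g x \<partial>tilt M h) = (\<integral>x. exp (- h x) / (\<integral>y. exp (- h y) \<partial>M) * g x \<partial>M)"
  unfolding tilt_def using integral_exp_minus_pos[OF h] ess_boundedD[OF h] g
  by (subst integral_density) auto

lemma (in prob_space) prob_space_tilt:
  assumes h: "ess_bounded M h"
  shows "prob_space (tilt M h)"
proof
  let ?Z = "\<integral>y. exp (- h y) \<partial>M"
  have Z: "0 < ?Z" by (rule integral_exp_minus_pos[OF h])
  have m: "h \<in> borel_measurable M" by (rule ess_boundedD[OF h])
  have int: "integrable M (\<lambda>x. exp (- h x))"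
    by (intro integrable_ess_bounded ess_bounded_exp_minus h)
  have "emeasure (tilt M h) (space M) = (\<integral>\<^sup>+x. ennreal (exp (- h x) / ?Z) \<partial>M)"
    unfolding tilt_def using m by (subst emeasure_density) (auto intro!: nn_integral_cong)
  also have "\<dots> = ennreal (\<integral>x. exp (- h x) / ?Z \<partial>M)"
    using int Z by (intro nn_integral_eq_integral) auto
  finally show "emeasure (tilt M h) (space (tilt M h)) = 1" using Z by simp
qed

text \<open>Exponents add and normalisers multiply, so an update by the current loss can be analysed
  relative to the current Gibbs law without returning to the prior.\<close>

lemma (in prob_space) tilt_tilt:
  assumes h: "ess_bounded M h" and g: "ess_bounded M g"
  shows "tilt (tilt M h) g = tilt M (\<lambda>x. h x + g x)"
proof -
  let ?Z = "\<integral>y. exp (- h y) \<partial>M"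
  let ?Y = "\<integral>y. exp (- (h y + g y)) \<partial>M"
  have Z: "0 < ?Z" by (rule integral_exp_minus_pos[OF h])
  have Y: "0 < ?Y" by (intro integral_exp_minus_pos ess_bounded_add h g)
  have [measurable]: "h \<in> borel_measurable M" "g \<in> borel_measurable M"
    using h g by (auto dest: ess_boundedD)
  \<comment> \<open>The second normaliser is a ratio of partition functions, and its denominator
    cancels the first normaliser.\<close>
  have YZ: "(\<integral>y. exp (- g y) \<partial>tilt M h) = ?Y / ?Z"
    by (subst integral_tilt[OF h]) (simp_all add: mult_exp_exp flip: exp_add)
  have "tilt (tilt M h) g = density (tilt M h) (\<lambda>x. ennreal (exp (- g x) / (?Y / ?Z)))"
    by (simp add: tilt_def[of "tilt M h"] YZ)
  also have "\<dots> = density M (\<lambda>x. ennreal (exp (- h x) / ?Z) * ennreal (exp (- g x) / (?Y / ?Z)))"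
    unfolding tilt_def by (rule density_density_eq) auto
  also have "\<dots> = tilt M (\<lambda>x. h x + g x)"
    unfolding tilt_def
  proof (rule density_cong)
    show "AE x in M. ennreal (exp (- h x) / ?Z) * ennreal (exp (- g x) / (?Y / ?Z)) =
      ennreal (exp (- (h x + g x)) / ?Y)"
    proof (rule AE_I2)
      fix x
      have "exp (- h x) / ?Z * (exp (- g x) / (?Y / ?Z)) = exp (- (h x + g x)) / ?Y"
        using Z Y by (simp add: mult_exp_exp)
      then show "ennreal (exp (- h x) / ?Z) * ennreal (exp (- g x) / (?Y / ?Z)) =
          ennreal (exp (- (h x + g x)) / ?Y)"
        using Z Y by (subst ennreal_mult[symmetric]) simp_all
    qed
  qed auto
  finally show ?thesis .
qed

section \<open>Tilting by a nearly constant function\<close>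

text \<open>Since \<open>exp (- z) \<le> 1 / (1 + z)\<close>, it is enough that the quadratic times
  \<open>1 + z\<close> is at least 1; that product is \<open>1 + z\<^sup>2 * (1 + 2 * z)\<close>,
  and \<open>z \<ge> -1/2\<close>.\<close>

lemma exp_minus_le_quadratic:
  fixes z :: real
  assumes "\<bar>z\<bar> \<le> 1/2"
  shows "exp (- z) \<le> 1 - z + 2 * z\<^sup>2"
proof -
  have 1: "1 + z \<le> exp z" by (rule exp_ge_add_one_self)
  have "exp (- z) \<le> 1 / (1 + z)"
    using 1 assms by (auto simp: exp_minus divide_simps abs_if split: if_splits)
  also have "\<dots> \<le> 1 - z + 2 * z\<^sup>2"
  proof -
    have "0 \<le> z\<^sup>2 * (1 + 2 * z)" using assms by (intro mult_nonneg_nonneg) auto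
    then have "1 \<le> (1 - z + 2 * z\<^sup>2) * (1 + z)" by (simp add: algebra_simps power2_eq_square)
    then show ?thesis using assms by (subst pos_divide_le_eq) auto
  qed
  finally show ?thesis .
qed

lemma ess_bounded_near:
  assumes "h \<in> borel_measurable M" "AE x in M. \<bar>h x - a\<bar> \<le> r"
  shows "ess_bounded M h"
proof -
  have "AE x in M. \<bar>h x\<bar> \<le> \<bar>a\<bar> + r" using assms(2) by eventually_elim simp
  then show ?thesis using assms(1) by (auto simp: ess_bounded_def)
qed

text \<open>A converse, up to a quadratic error, of the Jensen bound
  \<open>- ln (E (exp (- h))) \<le> E h\<close>. The factor \<open>exp a\<close> centres
  \<open>h\<close>; the quadratic bound on \<open>exp\<close> is integrated, and
  \<open>ln y \<le> y - 1\<close> turns the result into a bound on the logarithm, in which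
  \<open>a\<close> cancels.\<close>

lemma (in prob_space) expectation_le_log_partition:
  fixes h :: "'a \<Rightarrow> real"
  assumes h: "h \<in> borel_measurable M" "AE x in M. \<bar>h x - a\<bar> \<le> r" and r: "r \<le> 1/4"
  shows "(\<integral>x. h x \<partial>M) \<le> - ln (\<integral>x. exp (- h x) \<partial>M) + 2 * r\<^sup>2"
proof -
  have hb: "ess_bounded M h" by (rule ess_bounded_near[OF h])
  have int: "integrable M h" "integrable M (\<lambda>x. exp (- h x))"
    by (intro integrable_ess_bounded hb ess_bounded_exp_minus)+
  have "exp a * (\<integral>x. exp (- h x) \<partial>M) = (\<integral>x. exp a * exp (- h x) \<partial>M)" by simp
  also have "\<dots> \<le> (\<integral>x. 1 - (h x - a) + 2 * r\<^sup>2 \<partial>M)"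
  proof (rule integral_mono_AE)
    show "AE x in M. exp a * exp (- h x) \<le> 1 - (h x - a) + 2 * r\<^sup>2"
      using h(2)
    proof eventually_elim
      case (elim x)
      have "exp a * exp (- h x) = exp (- (h x - a))" by (simp add: mult_exp_exp)
      also have "\<dots> \<le> 1 - (h x - a) + 2 * (h x - a)\<^sup>2"
        by (rule exp_minus_le_quadratic) (use elim r in auto)
      also have "(h x - a)\<^sup>2 \<le> r\<^sup>2" using elim by (metis abs_ge_zero power2_abs power_mono)
      finally show ?case by simp
    qed
  qed (use int in auto)
  also have "\<dots> = 1 - ((\<integral>x. h x \<partial>M) - a) + 2 * r\<^sup>2" using int by (simp add: prob_space)
  finally have le: "exp a * (\<integral>x. exp (- h x) \<partial>M) \<le> 1 - ((\<integral>x. h x \<partial>M) - a) + 2 * r\<^sup>2" .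
  have pos: "0 < (\<integral>x. exp (- h x) \<partial>M)" by (rule integral_exp_minus_pos[OF hb])
  have "a + ln (\<integral>x. exp (- h x) \<partial>M) = ln (exp a * (\<integral>x. exp (- h x) \<partial>M))"
    using pos by (simp add: ln_mult)
  also have "\<dots> \<le> exp a * (\<integral>x. exp (- h x) \<partial>M) - 1"
    using pos by (intro ln_le_minus_one) simp
  finally show ?thesis using le by linarith
qed

text \<open>Numerator and normaliser both lie between \<open>exp (- r - a)\<close> and
  \<open>exp (r - a)\<close>, so their ratio lies between \<open>exp (- 2 * r)\<close> and
  \<open>exp (2 * r)\<close>, which are within \<open>4 * r\<close> of 1 because
  \<open>2 * r \<le> 1/2\<close>.\<close>

lemma (in prob_space) tilt_density_near_one:
  fixes h :: "'a \<Rightarrow> real"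
  assumes h: "h \<in> borel_measurable M" "AE x in M. \<bar>h x - a\<bar> \<le> r" and r: "0 \<le> r" "r \<le> 1/4"
  shows "AE x in M. \<bar>1 - exp (- h x) / (\<integral>y. exp (- h y) \<partial>M)\<bar> \<le> 4 * r"
proof -
  let ?Z = "\<integral>y. exp (- h y) \<partial>M"
  have hb: "ess_bounded M h" by (rule ess_bounded_near[OF h])
  have int: "integrable M (\<lambda>x. exp (- h x))"
    by (intro integrable_ess_bounded hb ess_bounded_exp_minus)
  have Z: "0 < ?Z" by (rule integral_exp_minus_pos[OF hb])
  have "?Z \<le> (\<integral>x. exp (r - a) \<partial>M)"
    by (rule integral_mono_AE) (use int h(2) in \<open>auto elim!: eventually_mono\<close>)
  then have Zu: "?Z \<le> exp (r - a)" by (simp add: prob_space)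
  have "(\<integral>x. exp (- r - a) \<partial>M) \<le> ?Z"
    by (rule integral_mono_AE) (use int h(2) in \<open>auto elim!: eventually_mono\<close>)
  then have Zl: "exp (- r - a) \<le> ?Z" by (simp add: prob_space)
  have e: "exp (2 * r) \<le> 1 + 4 * r"
    using exp_bound_lemma[of "2 * r"] r by simp
  have e': "1 - 4 * r \<le> exp (- 2 * r)"
    using exp_ge_add_one_self[of "- 2 * r"] r by linarith
  show ?thesis
    using h(2)
  proof eventually_elim
    case (elim x)
    have "exp (- h x) \<le> exp (2 * r) * exp (- r - a)"
      using elim by (simp add: mult_exp_exp)
    also have "\<dots> \<le> exp (2 * r) * ?Z" using Zl by simp
    also have "\<dots> \<le> (1 + 4 * r) * ?Z" using e Z by simp
    finally have u: "exp (- h x) / ?Z \<le> 1 + 4 * r" using Z by (simp add: pos_divide_le_eq)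
    have "(1 - 4 * r) * ?Z \<le> exp (- 2 * r) * ?Z" using e' Z by simp
    also have "\<dots> \<le> exp (- 2 * r) * exp (r - a)" using Zu by simp
    also have "\<dots> \<le> exp (- h x)" using elim by (simp add: mult_exp_exp)
    finally have "1 - 4 * r \<le> exp (- h x) / ?Z" using Z by (simp add: pos_le_divide_eq)
    with u show ?case by linarith
  qed
qed

lemma (in prob_space) ess_bounded_index:
  assumes f: "vec_measurable n M f" "\<And>x. x \<in> space M \<Longrightarrow> f x \<in> carrier_vec n"
    and bounded: "\<And>x. x \<in> space M \<Longrightarrow> enorm (f x - z') \<le> D" and z': "z' \<in> carrier_vec n"
    and i: "i < n"
  shows "ess_bounded M (\<lambda>x. f x $ i)"
proof (rule ess_bounded_near)
  show "AE x in M. \<bar>f x $ i - z' $ i\<bar> \<le> D"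
  proof (rule AE_I2)
    fix x assume x: "x \<in> space M"
    show "\<bar>f x $ i - z' $ i\<bar> \<le> D"
      using abs_index_le_enorm[of i "f x - z'"] bounded[OF x] z' i by simp
  qed
qed (use f i in \<open>simp add: vec_measurable_def\<close>)

text \<open>The difference \<open>v\<close> of the two means is the integral of
  \<open>(f - z') * (1 - g)\<close>, where \<open>g\<close> is the density of the tilt:
  \<open>1 - g\<close> integrates to 0, so the reference point \<open>z'\<close> can be subtracted
  and only the spread \<open>D\<close> matters. Pairing \<open>v\<close> with itself under the
  integral gives a bound linear in \<open>enorm v\<close>, with no factor \<open>n\<close>.\<close>

lemma (in prob_space) enorm_vec_integral_tilt:
  fixes h :: "'a \<Rightarrow> real"
  assumes h: "h \<in> borel_measurable M" "AE x in M. \<bar>h x - a\<bar> \<le> r" and r: "0 \<le> r" "r \<le> 1/4"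
    and f: "vec_measurable n M f" "\<And>x. x \<in> space M \<Longrightarrow> f x \<in> carrier_vec n"
    and bounded: "\<And>x. x \<in> space M \<Longrightarrow> enorm (f x - z') \<le> D" and z': "z' \<in> carrier_vec n"
  shows "enorm (vec_integral n M f - vec_integral n (tilt M h) f) \<le> 4 * r * D"
proof -
  define g where "g x = exp (- h x) / (\<integral>y. exp (- h y) \<partial>M)" for x
  define v where "v = vec_integral n M f - vec_integral n (tilt M h) f"
  have v: "v \<in> carrier_vec n" by (simp add: v_def vec_integral_def)
  have hb: "ess_bounded M h" by (rule ess_bounded_near[OF h])
  have Z: "0 < (\<integral>y. exp (- h y) \<partial>M)" by (rule integral_exp_minus_pos[OF hb])
  have [measurable]: "h \<in> borel_measurable M" by fact
  have gm [measurable]: "g \<in> borel_measurable M" unfolding g_def by measurable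
  have g1: "(\<integral>x. g x \<partial>M) = 1" using Z by (simp add: g_def)
  have g: "AE x in M. \<bar>1 - g x\<bar> \<le> 4 * r"
    unfolding g_def by (rule tilt_density_near_one[OF h r])
  then have gb: "ess_bounded M (\<lambda>x. g x)"
    by (intro ess_bounded_near[OF gm, of 1]) (simp add: abs_minus_commute)
  obtain x0 where x0: "x0 \<in> space M" using not_empty by blast
  have D: "0 \<le> D" using bounded[OF x0] order_trans[OF enorm_nonneg] by blast
  have fb: "ess_bounded M (\<lambda>x. f x $ i)" if "i < n" for i
    using ess_bounded_index[OF f bounded z' that] .
  have prod: "integrable M (\<lambda>x. (f x $ i - z' $ i) * (1 - g x))" if i: "i < n" for i
  proof (rule integrable_const_bound)
    show "AE x in M. norm ((f x $ i - z' $ i) * (1 - g x)) \<le> D * (4 * r)"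
      using g AE_space
    proof eventually_elim
      case (elim x)
      have "\<bar>f x $ i - z' $ i\<bar> \<le> D"
        using abs_index_le_enorm[of i "f x - z'"] bounded[of x] elim z' i by simp
      then show ?case using elim D by (simp add: abs_mult mult_mono)
    qed
    have [measurable]: "(\<lambda>x. f x $ i) \<in> borel_measurable M" using fb[OF i] by (rule ess_boundedD)
    show "(\<lambda>x. (f x $ i - z' $ i) * (1 - g x)) \<in> borel_measurable M" by measurable
  qed
  have vi: "v $ i = (\<integral>x. (f x $ i - z' $ i) * (1 - g x) \<partial>M)" if i: "i < n" for i
  proof -
    have fi: "integrable M (\<lambda>x. f x $ i)" and gi: "integrable M g"
      using fb[OF i] gb by (auto intro: integrable_ess_bounded)
    have gf: "integrable M (\<lambda>x. g x * f x $ i)"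
    proof -
      \<comment> \<open>Expanding the last product shows that this integrand is
        \<open>g x * f x $ i\<close>; integrability is thus inherited from the centred
        product.\<close>
      have "integrable M (\<lambda>x. f x $ i - z' $ i + z' $ i * g x - (f x $ i - z' $ i) * (1 - g x))"
        using fi gi prod[OF i] by (intro Bochner_Integration.integrable_add
            Bochner_Integration.integrable_diff integrable_mult_right) auto
      then show ?thesis by (simp add: algebra_simps)
    qed
    have "v $ i = (\<integral>x. f x $ i \<partial>M) - (\<integral>x. g x * f x $ i \<partial>M)"
      using i f integral_tilt[OF hb, of "\<lambda>x. f x $ i"]
      by (simp add: v_def vec_integral_def g_def vec_measurable_def)
    \<comment> \<open>The inserted term is the constant \<open>z' $ i\<close> times
      \<open>1 - g\<close>, whose integral is 0.\<close>
    also have "\<dots> = (\<integral>x. f x $ i - g x * f x $ i - (z' $ i - z' $ i * g x) \<partial>M)"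
      using fi gi gf g1 by (simp add: prob_space)
    finally show ?thesis by (simp add: algebra_simps)
  qed
  have "(enorm v)\<^sup>2 = (\<Sum>i<n. v $ i * v $ i)"
    using v unfolding scalar_prod_self[symmetric] by (simp add: scalar_prod_def atLeast0LessThan)
  also have "\<dots> = (\<Sum>i<n. \<integral>x. v $ i * ((f x $ i - z' $ i) * (1 - g x)) \<partial>M)"
    by (intro sum.cong refl) (simp flip: vi)
  also have "\<dots> = (\<integral>x. (\<Sum>i<n. v $ i * ((f x $ i - z' $ i) * (1 - g x))) \<partial>M)"
    using prod by (subst Bochner_Integration.integral_sum) auto
  also have "\<dots> \<le> (\<integral>x. enorm v * (4 * r * D) \<partial>M)"
  proof (rule integral_mono_AE)
    show "AE x in M. (\<Sum>i<n. v $ i * ((f x $ i - z' $ i) * (1 - g x))) \<le> enorm v * (4 * r * D)"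
      using g AE_space
    proof eventually_elim
      case (elim x)
      let ?d = "(1 - g x) \<cdot>\<^sub>v (f x - z')"
      have fx: "f x \<in> carrier_vec n" using f elim by auto
      have "(\<Sum>i<n. v $ i * ((f x $ i - z' $ i) * (1 - g x))) = v \<bullet> ?d"
        using fx z' by (auto simp: scalar_prod_def atLeast0LessThan intro!: sum.cong)
      also have "\<dots> \<le> enorm v * enorm ?d"
        using v z' fx by (intro scalar_prod_le_enorm[of _ n]) auto
      also have "enorm ?d \<le> 4 * r * D"
        unfolding enorm_smult using elim bounded[of x] D r by (intro mult_mono) auto
      finally show ?case by (simp add: mult_left_mono)
    qed
  qed (use prod in \<open>auto intro!: Bochner_Integration.integrable_sum\<close>)
  also have "\<dots> = enorm v * (4 * r * D)" by (simp add: prob_space)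
  finally have "enorm v * enorm v \<le> enorm v * (4 * r * D)" by (simp add: power2_eq_square)
  then have "enorm v \<le> 4 * r * D"
    using D r enorm_nonneg[of v] by (cases "enorm v = 0") (auto simp: mult_le_cancel_left)
  then show ?thesis by (simp add: v_def)
qed

text \<open>The Donsker--Varadhan inequality, from \<open>ln z \<le> z - 1\<close> at \<open>z = exp (- h) / (Z * d\<rho>/dM)\<close>.\<close>

lemma (in prob_space) log_partition_le_KL:
  assumes h: "ess_bounded M h" and \<rho>: "prob_space \<rho>" "sets \<rho> = sets M" "absolutely_continuous M \<rho>"
    and ent: "integrable \<rho> (entropy_density (exp 1) M \<rho>)"
  shows "- ln (\<integral>x. exp (- h x) \<partial>M) \<le> (\<integral>x. h x \<partial>\<rho>) + KL_divergence (exp 1) M \<rho>"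
proof -
  interpret R: prob_space \<rho> by fact
  define Z where "Z = (\<integral>x. exp (- h x) \<partial>M)"
  have Z: "0 < Z" unfolding Z_def by (rule integral_exp_minus_pos[OF h])
  have [measurable]: "h \<in> borel_measurable M" by (rule ess_boundedD[OF h])
  obtain D where D: "D \<in> borel_measurable M" "AE x in M. RN_deriv M \<rho> x = ennreal (D x)"
    "AE x in \<rho>. 0 < D x" "\<And>x. 0 \<le> D x"
    using real_RN_deriv[OF R.finite_measure_axioms \<rho>(3,2)] by blast
  have [measurable]: "D \<in> borel_measurable M" by fact
  have "\<rho> = density M (RN_deriv M \<rho>)"
    using density_RN_deriv[OF \<rho>(3,2)] by simp
  also have "\<dots> = density M (\<lambda>x. ennreal (D x))"
    using D by (intro density_cong) auto
  finally have \<rho>_eq: "\<rho> = density M (\<lambda>x. ennreal (D x))" .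
  have D\<rho>: "AE x in \<rho>. RN_deriv M \<rho> x = ennreal (D x)"
    using absolutely_continuous_AE[OF \<rho>(2,3) D(2)] .
  have hR: "integrable \<rho> h"
    by (intro R.integrable_ess_bounded ess_bounded_absolutely_continuous[OF h \<rho>(2,3)])
  define g where "g x = exp (- h x) / (Z * D x)" for x
  have [measurable]: "g \<in> borel_measurable M" unfolding g_def by measurable
  have ez: "integrable M (\<lambda>x. exp (- h x) / Z)"
    using integrable_ess_bounded[OF ess_bounded_exp_minus[OF h]] by simp
  \<comment> \<open>Equality holds where \<open>D x > 0\<close>. Where \<open>D x = 0\<close>,
    division by zero makes \<open>g x = 0\<close>, so in general only an inequality is available; it
    points in the direction required.\<close>
  have Dg: "0 \<le> D x * g x" "D x * g x \<le> exp (- h x) / Z" for x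
    using D(4)[of x] Z by (auto simp: g_def field_simps)
  have Dgi: "integrable M (\<lambda>x. D x * g x)"
    by (rule Bochner_Integration.integrable_bound[OF ez]) (use Dg Z in \<open>auto simp: abs_le_iff\<close>)
  have gi: "integrable \<rho> g"
    unfolding \<rho>_eq using Dgi D(4) by (subst integrable_density) auto
  have "(\<integral>x. g x \<partial>\<rho>) = (\<integral>x. D x * g x \<partial>M)"
    unfolding \<rho>_eq using D(4) by (subst integral_density) auto
  also have "\<dots> \<le> (\<integral>x. exp (- h x) / Z \<partial>M)"
    by (rule integral_mono[OF Dgi ez]) (rule Dg)
  also have "\<dots> = 1" using Z by (simp add: Z_def)
  finally have g1: "(\<integral>x. g x \<partial>\<rho>) \<le> 1" .
  have "(\<integral>x. - h x - ln Z - entropy_density (exp 1) M \<rho> x \<partial>\<rho>) \<le> (\<integral>x. g x - 1 \<partial>\<rho>)"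
  proof (rule integral_mono_AE)
    show "AE x in \<rho>. - h x - ln Z - entropy_density (exp 1) M \<rho> x \<le> g x - 1"
      using D(3) D\<rho>
    proof eventually_elim
      case (elim x)
      have "- h x - ln Z - entropy_density (exp 1) M \<rho> x = ln (g x)"
        using elim Z by (simp add: entropy_density_def g_def log_def ln_div ln_mult)
      also have "\<dots> \<le> g x - 1"
        using elim Z by (intro ln_le_minus_one) (simp add: g_def)
      finally show ?case .
    qed
  qed (use hR ent gi in auto)
  then have "- (\<integral>x. h x \<partial>\<rho>) - ln Z - KL_divergence (exp 1) M \<rho> \<le> (\<integral>x. g x \<partial>\<rho>) - 1"
    using hR ent gi by (simp add: KL_divergence_def R.prob_space)
  then show ?thesis using g1 by (simp add: Z_def)
qed

section \<open>Jensen's inequality for vector-valued maps\<close>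

text \<open>Finite Jensen together with membership of the combination. One point is split off and
  the remaining weights are renormalised by \<open>1 - a k\<close>, hence the induction over
  arbitrary \<open>a\<close>; the case \<open>a k = 1\<close>, where this would divide by zero, is
  separate.\<close>

lemma vec_convex_on_sum:
  assumes conv: "vec_convex_on H \<phi>" and I: "finite I" "sum a I = 1" "\<And>i. i \<in> I \<Longrightarrow> 0 \<le> a i"
    and z: "\<And>i. i \<in> I \<Longrightarrow> z i \<in> H" "\<And>i. i \<in> I \<Longrightarrow> z i \<in> carrier_vec n"
  shows "vec n (\<lambda>j. \<Sum>i\<in>I. a i * z i $ j) \<in> H \<and>
    \<phi> (vec n (\<lambda>j. \<Sum>i\<in>I. a i * z i $ j)) \<le> (\<Sum>i\<in>I. a i * \<phi> (z i))"
  using I z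
proof (induction I arbitrary: a rule: finite_induct)
  case empty
  then show ?case by simp
next
  case (insert k I)
  show ?case
  proof (cases "a k = 1")
    case True
    then have "sum a I = 0" using insert by simp
    then have 0: "a i = 0" if "i \<in> I" for i
      using sum_nonneg_eq_0_iff[of I a] insert that by auto
    have "vec n (\<lambda>j. \<Sum>i\<in>insert k I. a i * z i $ j) = z k"
    proof (rule eq_vecI)
      have "dim_vec (z k) = n" using insert.prems(4)[of k] by simp
      then show "dim_vec (vec n (\<lambda>j. \<Sum>i\<in>insert k I. a i * z i $ j)) = dim_vec (z k)"
        and "\<And>j. j < dim_vec (z k) \<Longrightarrow> vec n (\<lambda>j. \<Sum>i\<in>insert k I. a i * z i $ j) $ j = z k $ j"
        using insert.hyps True 0 by simp_all
    qed
    moreover have "(\<Sum>i\<in>insert k I. a i * \<phi> (z i)) = \<phi> (z k)"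
      using insert True 0 by simp
    ultimately show ?thesis using insert by simp
  next
    case False
    have nn: "0 \<le> sum a I" by (rule sum_nonneg) (use insert in auto)
    have S: "sum a I = 1 - a k" using insert by simp
    then have lt: "0 < 1 - a k" using False nn by simp
    define b where "b i = a i / (1 - a k)" for i
    define m where "m = vec n (\<lambda>j. \<Sum>i\<in>I. b i * z i $ j)"
    have IH: "m \<in> H \<and> \<phi> m \<le> (\<Sum>i\<in>I. b i * \<phi> (z i))"
      unfolding m_def
    proof (rule insert.IH)
      show "sum b I = 1" using S lt by (simp add: b_def flip: sum_divide_distrib)
    qed (use insert lt in \<open>auto simp: b_def\<close>)
    have *: "vec n (\<lambda>j. \<Sum>i\<in>insert k I. a i * z i $ j) = a k \<cdot>\<^sub>v z k + (1 - a k) \<cdot>\<^sub>v m"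
    proof (rule eq_vecI)
      fix j assume "j < dim_vec (a k \<cdot>\<^sub>v z k + (1 - a k) \<cdot>\<^sub>v m)"
      then have j: "j < n" by (simp add: m_def)
      have "(\<Sum>i\<in>I. a i * z i $ j) = (1 - a k) * (\<Sum>i\<in>I. b i * z i $ j)"
        unfolding sum_distrib_left using lt by (intro sum.cong refl) (simp add: b_def)
      then show "vec n (\<lambda>j. \<Sum>i\<in>insert k I. a i * z i $ j) $ j = (a k \<cdot>\<^sub>v z k + (1 - a k) \<cdot>\<^sub>v m) $ j"
        using j insert.hyps insert.prems(4)[of k] by (simp add: m_def)
    qed (simp add: m_def)
    have c: "a k \<cdot>\<^sub>v z k + (1 - a k) \<cdot>\<^sub>v m \<in> H \<and>
        \<phi> (a k \<cdot>\<^sub>v z k + (1 - a k) \<cdot>\<^sub>v m) \<le> a k * \<phi> (z k) + (1 - a k) * \<phi> m"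
      using conv IH insert lt by (simp add: vec_convex_on_def vec_convex_def)
    have "(1 - a k) * \<phi> m \<le> (1 - a k) * (\<Sum>i\<in>I. b i * \<phi> (z i))"
      using IH lt by (intro mult_left_mono) auto
    also have "\<dots> = (\<Sum>i\<in>I. a i * \<phi> (z i))"
      unfolding sum_distrib_left using lt by (intro sum.cong refl) (simp add: b_def)
    finally have "a k * \<phi> (z k) + (1 - a k) * \<phi> m \<le> (\<Sum>i\<in>insert k I. a i * \<phi> (z i))"
      using insert by simp
    with c show ?thesis unfolding * by linarith
  qed
qed

text \<open>Measurability is asked only of the fibres of \<open>q\<close>, so \<open>g\<close> may
  be arbitrary and the codomain, below a set of integer lists, carries no sigma-algebra.\<close>

lemma (in prob_space) integral_finite_valued:
  fixes g :: "'b \<Rightarrow> real"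
  assumes Q: "finite Q" "\<And>x. x \<in> space M \<Longrightarrow> q x \<in> Q"
    and q: "\<And>k. {x \<in> space M. q x = k} \<in> sets M"
  shows "integrable M (\<lambda>x. g (q x))"
    and "(\<integral>x. g (q x) \<partial>M) = (\<Sum>k\<in>Q. prob {x \<in> space M. q x = k} * g k)"
proof -
  have eq: "g (q x) = (\<Sum>k\<in>Q. indicator {x \<in> space M. q x = k} x * g k)" if "x \<in> space M" for x
  proof -
    have "(\<Sum>k\<in>Q. indicator {x \<in> space M. q x = k} x * g k) = (\<Sum>k\<in>Q. if k = q x then g k else 0)"
      using that by (intro sum.cong) (auto simp: indicator_def)
    then show ?thesis using Q that by simp
  qed
  have int: "integrable M (\<lambda>x. indicator {x \<in> space M. q x = k} x * g k)" for k
    using q[of k] by (intro integrable_mult_left) (simp add: emeasure_eq_measure)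
  show "integrable M (\<lambda>x. g (q x))"
    using int by (subst Bochner_Integration.integrable_cong[OF refl eq]) auto
  have "(\<integral>x. g (q x) \<partial>M) = (\<integral>x. (\<Sum>k\<in>Q. indicator {x \<in> space M. q x = k} x * g k) \<partial>M)"
    by (intro Bochner_Integration.integral_cong eq refl)
  also have "\<dots> = (\<Sum>k\<in>Q. prob {x \<in> space M. q x = k} * g k)"
    using int q by (simp add: Int_absorb2 Collect_conj_eq inf_commute)
  finally show "(\<integral>x. g (q x) \<partial>M) = (\<Sum>k\<in>Q. prob {x \<in> space M. q x = k} * g k)" .
qed

text \<open>
  \<open>H\<close> need not be closed, so the mean of \<open>f\<close> is not obviously in \<open>H\<close>. Hence \<open>f\<close> is replaced by a finitely
  valued map with values in \<open>H\<close>, constant on the cells of a grid of mesh \<open>d\<close>; the mean of that map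
  lies in \<open>H\<close>, and the Lipschitz bound compares it with \<open>y\<close>.
\<close>

lemma (in prob_space) jensen_lipschitz:
  assumes conv: "vec_convex_on H \<phi>" and lip: "vec_lipschitz_on L H \<phi>"
    and f: "vec_measurable n M f" "\<And>x. x \<in> space M \<Longrightarrow> f x \<in> carrier_vec n"
    and bounded: "\<And>x. x \<in> space M \<Longrightarrow> enorm (f x - z') \<le> D" and z': "z' \<in> carrier_vec n"
    and S: "AE x in M. f x \<in> H"
    and y: "y \<in> H" "y \<in> carrier_vec n"
    and int: "integrable M (\<lambda>x. \<phi> (f x))"
  shows "\<phi> y \<le> (\<integral>x. \<phi> (f x) \<partial>M) + L * enorm (y - vec_integral n M f)"
proof -
  have L: "0 \<le> L" using lip by (simp add: vec_lipschitz_on_def)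
  \<comment> \<open>The grid error occurs twice: in replacing \<open>f\<close> by its
    representatives under the integral of \<open>\<phi>\<close>, and in replacing the mean of
    \<open>f\<close> by the mean \<open>m\<close> of the representatives.\<close>
  have approx: "\<phi> y \<le> (\<integral>x. \<phi> (f x) \<partial>M) + L * enorm (y - vec_integral n M f) + 2 * L * (real n * d)"
    if d: "0 < d" for d
  proof -
    \<comment> \<open>The grid cell of \<open>f x\<close>, as a list of integer coordinates. The
      bounds \<open>a\<close> and \<open>b\<close> below confine these lists to a finite set; the
      inserted 0 keeps \<open>Min\<close> and \<open>Max\<close> meaningful for
      \<open>n = 0\<close>.\<close>
    define q where "q x = map (\<lambda>i. \<lfloor>f x $ i / d\<rfloor>) [0..<n]" for x
    define a where "a = Min (insert 0 ((\<lambda>i. \<lfloor>(z' $ i - D) / d\<rfloor>) ` {..<n}))"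
    define b where "b = Max (insert 0 ((\<lambda>i. \<lfloor>(z' $ i + D) / d\<rfloor>) ` {..<n}))"
    define Q where "Q = {xs :: int list. set xs \<subseteq> {a..b} \<and> length xs = n}"
    have fin: "finite Q" unfolding Q_def by (rule finite_lists_length_eq) simp
    have qQ: "q x \<in> Q" if x: "x \<in> space M" for x
    proof -
      have "a \<le> \<lfloor>f x $ i / d\<rfloor> \<and> \<lfloor>f x $ i / d\<rfloor> \<le> b" if i: "i < n" for i
      proof -
        have "\<bar>f x $ i - z' $ i\<bar> \<le> D"
          using abs_index_le_enorm[of i "f x - z'"] bounded[OF x] z' i by simp
        then have "\<lfloor>(z' $ i - D) / d\<rfloor> \<le> \<lfloor>f x $ i / d\<rfloor>" "\<lfloor>f x $ i / d\<rfloor> \<le> \<lfloor>(z' $ i + D) / d\<rfloor>"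
          using d by (auto intro!: floor_mono divide_right_mono)
        moreover have "a \<le> \<lfloor>(z' $ i - D) / d\<rfloor>" unfolding a_def using i by (intro Min_le) auto
        moreover have "\<lfloor>(z' $ i + D) / d\<rfloor> \<le> b" unfolding b_def using i by (intro Max_ge) auto
        ultimately show ?thesis by linarith
      qed
      then show ?thesis by (auto simp: Q_def q_def)
    qed
    have qm: "{x \<in> space M. q x = k} \<in> sets M" for k
    proof (cases "length k = n")
      case True
      have "{x \<in> space M. q x = k} = {x \<in> space M. \<forall>i\<in>{..<n}. \<lfloor>f x $ i / d\<rfloor> = k ! i}"
        using True by (auto simp: q_def list_eq_iff_nth_eq)
      also have "\<dots> \<in> sets M"
      proof (rule sets.sets_Collect_finite_All)
        fix i assume i: "i \<in> {..<n}"
        then have [measurable]: "(\<lambda>x. f x $ i) \<in> borel_measurable M" using f by (simp add: vec_measurable_def)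
        show "{x \<in> space M. \<lfloor>f x $ i / d\<rfloor> = k ! i} \<in> sets M" by measurable
      qed auto
      finally show ?thesis .
    next
      case False
      then have empty: "{x \<in> space M. q x = k} = {}" by (auto simp: q_def)
      show ?thesis unfolding empty by simp
    qed
    have "\<exists>x\<in>space M. f x \<in> H"
    proof (rule ccontr)
      assume "\<not> (\<exists>x\<in>space M. f x \<in> H)"
      then have "AE x in M. False" using S by (auto elim!: AE_mp)
      then show False by simp
    qed
    then obtain x0 where x0: "x0 \<in> space M" "f x0 \<in> H" by blast
    \<comment> \<open>A representative of cell \<open>k\<close>, chosen where \<open>f\<close> is in
      \<open>H\<close> if the cell has such a point. All other cells fall back on \<open>x0\<close>;
      they meet only the null set where \<open>f\<close> leaves \<open>H\<close>.\<close>
    define s where "s k = (if \<exists>x\<in>space M. q x = k \<and> f x \<in> H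
      then SOME x. x \<in> space M \<and> q x = k \<and> f x \<in> H else x0)" for k
    have s: "s k \<in> space M \<and> f (s k) \<in> H" for k
      using x0 someI_ex[of "\<lambda>x. x \<in> space M \<and> q x = k \<and> f x \<in> H"] by (auto simp: s_def)
    have qs: "q (s (q x)) = q x" if "x \<in> space M" "f x \<in> H" for x
      using that someI_ex[of "\<lambda>x'. x' \<in> space M \<and> q x' = q x \<and> f x' \<in> H"] by (auto simp: s_def)
    define z where "z k = f (s k)" for k
    have z: "z k \<in> H" "z k \<in> carrier_vec n" for k using s f by (auto simp: z_def)
    have coord: "\<bar>f x $ i - z (q x) $ i\<bar> \<le> d" if "x \<in> space M" "f x \<in> H" "i < n" for x i
    proof -
      have "q (s (q x)) ! i = q x ! i" using qs that by simp
      then have "\<lfloor>f x $ i / d\<rfloor> = \<lfloor>z (q x) $ i / d\<rfloor>" using that(3) by (simp add: q_def z_def)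
      then have "\<bar>f x $ i / d - z (q x) $ i / d\<bar> \<le> 1" by linarith
      then show ?thesis using d by (simp add: field_simps flip: diff_divide_distrib)
    qed
    have near: "enorm (f x - z (q x)) \<le> real n * d" if x: "x \<in> space M" "f x \<in> H" for x
    proof -
      have "enorm (f x - z (q x)) \<le> (\<Sum>i<n. \<bar>f x $ i - z (q x) $ i\<bar>)"
        using enorm_le_sum[of "f x - z (q x)"] z[of "q x"] by simp
      also have "\<dots> \<le> (\<Sum>i<n. d)" using coord x by (intro sum_mono) auto
      finally show ?thesis by simp
    qed
    define p where "p k = prob {x \<in> space M. q x = k}" for k
    define m where "m = vec n (\<lambda>j. \<Sum>k\<in>Q. p k * z k $ j)"
    have "sum p Q = 1"
      using integral_finite_valued(2)[OF fin qQ qm, of "\<lambda>_. 1"] by (simp add: p_def prob_space)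
    then have m: "m \<in> H \<and> \<phi> m \<le> (\<Sum>k\<in>Q. p k * \<phi> (z k))"
      unfolding m_def by (intro vec_convex_on_sum[OF conv fin]) (auto simp: z p_def)
    have m_int: "m $ i = (\<integral>x. z (q x) $ i \<partial>M)" if "i < n" for i
      using integral_finite_valued(2)[OF fin qQ qm, of "\<lambda>k. z k $ i"] that by (simp add: m_def p_def)
    have mc: "m \<in> carrier_vec n" by (simp add: m_def)
    have vc: "vec_integral n M f \<in> carrier_vec n" by (simp add: vec_integral_def)
    have "\<bar>vec_integral n M f $ i - m $ i\<bar> \<le> d" if i: "i < n" for i
    proof -
      have fi: "integrable M (\<lambda>x. f x $ i)"
        by (rule integrable_ess_bounded[OF ess_bounded_index[OF f bounded z' i]])
      have zi: "integrable M (\<lambda>x. z (q x) $ i)"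
        by (rule integral_finite_valued(1)[OF fin qQ qm, of "\<lambda>k. z k $ i"])
      have "\<bar>\<integral>x. f x $ i - z (q x) $ i \<partial>M\<bar> \<le> (\<integral>x. \<bar>f x $ i - z (q x) $ i\<bar> \<partial>M)"
        by (rule integral_abs_bound)
      also have "\<dots> \<le> (\<integral>x. d \<partial>M)"
      proof (rule integral_mono_AE)
        show "AE x in M. \<bar>f x $ i - z (q x) $ i\<bar> \<le> d"
          using S AE_space by eventually_elim (use coord i in auto)
      qed (use fi zi in auto)
      finally show ?thesis
        using fi zi i by (simp add: m_int vec_integral_def prob_space)
    qed
    then have "(\<Sum>i<n. \<bar>(vec_integral n M f - m) $ i\<bar>) \<le> (\<Sum>i<n. d)"
      using mc by (intro sum_mono) auto
    then have near_m: "enorm (vec_integral n M f - m) \<le> real n * d"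
      using enorm_le_sum[of "vec_integral n M f - m"] mc by simp
    have "(\<Sum>k\<in>Q. p k * \<phi> (z k)) = (\<integral>x. \<phi> (z (q x)) \<partial>M)"
      using integral_finite_valued(2)[OF fin qQ qm, of "\<lambda>k. \<phi> (z k)"] by (simp add: p_def)
    also have "\<dots> \<le> (\<integral>x. \<phi> (f x) + L * (real n * d) \<partial>M)"
    proof (rule integral_mono_AE)
      show "integrable M (\<lambda>x. \<phi> (z (q x)))"
        by (rule integral_finite_valued(1)[OF fin qQ qm, of "\<lambda>k. \<phi> (z k)"])
      show "AE x in M. \<phi> (z (q x)) \<le> \<phi> (f x) + L * (real n * d)"
        using S AE_space
      proof eventually_elim
        case (elim x)
        have "\<bar>\<phi> (f x) - \<phi> (z (q x))\<bar> \<le> L * enorm (f x - z (q x))"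
          using lip elim z by (simp add: vec_lipschitz_on_def)
        also have "\<dots> \<le> L * (real n * d)"
          using near elim L by (intro mult_left_mono) auto
        finally show ?case by linarith
      qed
    qed (use int in auto)
    also have "\<dots> = (\<integral>x. \<phi> (f x) \<partial>M) + L * (real n * d)"
      using int by (simp add: prob_space)
    finally have 1: "\<phi> m \<le> (\<integral>x. \<phi> (f x) \<partial>M) + L * (real n * d)" using m by linarith
    have "\<bar>\<phi> y - \<phi> m\<bar> \<le> L * enorm (y - m)"
      using lip y m by (simp add: vec_lipschitz_on_def)
    also have "\<dots> \<le> L * (enorm (y - vec_integral n M f) + real n * d)"
      using near_m enorm_diff_triangle[OF y(2) vc mc] L by (intro mult_left_mono) auto
    finally show ?thesis using 1 by (simp add: algebra_simps)
  qed
  show ?thesis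
  proof (rule field_le_epsilon)
    fix e :: real assume e: "0 < e"
    \<comment> \<open>Chosen so that the total grid error \<open>2 * L * (real n * d)\<close> is at
      most \<open>e\<close>, including when \<open>L\<close> or \<open>n\<close> is 0.\<close>
    define d where "d = e / (2 * L * real n + 1)"
    have pos: "0 < 2 * L * real n + 1" using L by (simp add: add_nonneg_pos)
    have "2 * L * (real n * d) = e * ((2 * L * real n) / (2 * L * real n + 1))" by (simp add: d_def)
    also have "\<dots> \<le> e * 1" using pos e by (intro mult_left_mono) (auto simp: field_simps)
    finally show "\<phi> y \<le> (\<integral>x. \<phi> (f x) \<partial>M) + L * enorm (y - vec_integral n M f) + e"
      using approx[of d] e pos by (simp add: d_def)
  qed
qed

section \<open>Counterfactual trajectories and tracking\<close>

text \<open>The induction on \<open>t\<close> keeps the block index \<open>r\<close> arbitrary,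
  since applying the closed-loop matrix once turns block \<open>r\<close> into block
  \<open>r + 1\<close>. This unrolls the recursion without writing \<open>e t\<close> as a sum of
  matrix powers; the displacement of the last step contributes the term
  \<open>j = 0\<close>.\<close>

lemma enorm_tracking_block:
  assumes A: "A \<in> carrier_mat n n" and B: "B \<in> carrier_mat n k" and K: "K \<in> carrier_mat k n"
    and e: "e 1 = 0\<^sub>v n"
    and rec: "\<And>t. 1 \<le> t \<Longrightarrow> t < T \<Longrightarrow> e (Suc t) = (A - B * K) *\<^sub>v e t + d t"
    and d: "\<And>t. 1 \<le> t \<Longrightarrow> t < T \<Longrightarrow> d t \<in> carrier_vec n \<and> enorm (d t) \<le> \<delta>"
    and t: "1 \<le> t" "t \<le> T"
  shows "e t \<in> carrier_vec n \<and>
    enorm (tracking_block A B K r *\<^sub>v e t) \<le> (\<Sum>j<t - 1. opnorm (tracking_block A B K (r + j))) * \<delta>"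
  using t
proof (induction t arbitrary: r rule: nat_induct_at_least)
  case base
  have "tracking_block A B K r *\<^sub>v 0\<^sub>v n = 0\<^sub>v (dim_row (tracking_block A B K r))"
    using A by (intro eq_vecI) (auto simp: tracking_block_def scalar_prod_def)
  then show ?case using e by simp
next
  case (Suc t)
  define F where "F = A - B * K"
  define G where "G = 1\<^sub>m n @\<^sub>r (- K)"
  have F: "F \<in> carrier_mat n n" using A B K by (simp add: F_def minus_carrier_mat)
  have G: "G \<in> carrier_mat (n + k) n" using K unfolding G_def by (intro carrier_append_rows) auto
  have blk: "tracking_block A B K r = G * F ^\<^sub>m r" for r
    using A by (simp add: tracking_block_def F_def G_def)
  have Fr: "F ^\<^sub>m r \<in> carrier_mat n n" for r using F by (rule pow_carrier_mat)
  have blk_c: "tracking_block A B K r \<in> carrier_mat (n + k) n" for r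
    unfolding blk by (rule mult_carrier_mat[OF G Fr])
  have et: "e t \<in> carrier_vec n" using Suc by auto
  have dt: "d t \<in> carrier_vec n" "enorm (d t) \<le> \<delta>" using d[of t] Suc by auto
  have Fe: "F *\<^sub>v e t \<in> carrier_vec n" using F et by simp
  have step: "e (Suc t) = F *\<^sub>v e t + d t" using rec[of t] Suc by (simp add: F_def)
  have shift: "tracking_block A B K r *\<^sub>v (F *\<^sub>v e t) = tracking_block A B K (Suc r) *\<^sub>v e t"
    unfolding blk pow_mat.simps(2) assoc_mult_mat_vec[OF G Fr Fe]
      assoc_mult_mat_vec[OF G mult_carrier_mat[OF Fr F] et] assoc_mult_mat_vec[OF Fr F et] ..
  have "tracking_block A B K r *\<^sub>v e (Suc t) =
      tracking_block A B K (Suc r) *\<^sub>v e t + tracking_block A B K r *\<^sub>v d t"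
    unfolding step mult_add_distrib_mat_vec[OF blk_c Fe dt(1)] shift by simp
  also have "enorm \<dots> \<le> enorm (tracking_block A B K (Suc r) *\<^sub>v e t) + enorm (tracking_block A B K r *\<^sub>v d t)"
    using blk_c et dt by (intro enorm_triangle[of _ "n + k"] mult_mat_vec_carrier) auto
  also have "\<dots> \<le> (\<Sum>j<t - 1. opnorm (tracking_block A B K (Suc r + j))) * \<delta>
      + opnorm (tracking_block A B K r) * \<delta>"
  proof (rule add_mono)
    show "enorm (tracking_block A B K (Suc r) *\<^sub>v e t) \<le> (\<Sum>j<t - 1. opnorm (tracking_block A B K (Suc r + j))) * \<delta>"
      using Suc.IH[of "Suc r"] Suc.prems by simp
    have "enorm (tracking_block A B K r *\<^sub>v d t) \<le> opnorm (tracking_block A B K r) * enorm (d t)"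
      using blk_c[of r] dt by (intro enorm_mult_mat_vec) auto
    also have "\<dots> \<le> opnorm (tracking_block A B K r) * \<delta>"
      using dt by (intro mult_left_mono opnorm_nonneg)
    finally show "enorm (tracking_block A B K r *\<^sub>v d t) \<le> opnorm (tracking_block A B K r) * \<delta>" .
  qed
  also have "\<dots> = (\<Sum>j<Suc (t - 1). opnorm (tracking_block A B K (r + j))) * \<delta>"
    unfolding sum.lessThan_Suc_shift by (simp add: algebra_simps)
  finally show ?case
    using Suc.hyps F et dt by (simp add: step)
qed

lemma (in prob_space) vec_integral_affine:
  assumes N: "N \<in> carrier_mat m n" and b: "b \<in> carrier_vec m"
    and f: "\<And>x. x \<in> space M \<Longrightarrow> f x \<in> carrier_vec n"
    and int: "\<And>j. j < n \<Longrightarrow> integrable M (\<lambda>x. f x $ j)"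
  shows "vec_integral m M (\<lambda>x. N *\<^sub>v f x + b) = N *\<^sub>v vec_integral n M f + b"
proof (rule eq_vecI)
  fix i assume "i < dim_vec (N *\<^sub>v vec_integral n M f + b)"
  then have i: "i < m" using b by simp
  have "(\<integral>x. (N *\<^sub>v f x + b) $ i \<partial>M) = (\<integral>x. (\<Sum>j<n. N $$ (i, j) * f x $ j) + b $ i \<partial>M)"
    using f N b i by (intro Bochner_Integration.integral_cong refl)
      (fastforce simp: scalar_prod_def atLeast0LessThan intro!: sum.cong)
  also have "\<dots> = (\<Sum>j<n. N $$ (i, j) * (\<integral>x. f x $ j \<partial>M)) + b $ i"
  proof -
    have "integrable M (\<lambda>x. N $$ (i, j) * f x $ j)" if "j < n" for j
      using int[OF that] by simp
    then show ?thesis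
      by (subst Bochner_Integration.integral_add) (auto simp: Bochner_Integration.integral_sum prob_space)
  qed
  also have "\<dots> = (N *\<^sub>v vec_integral n M f + b) $ i"
    using i N b by (simp add: scalar_prod_def vec_integral_def atLeast0LessThan)
  finally show "vec_integral m M (\<lambda>x. N *\<^sub>v f x + b) $ i = (N *\<^sub>v vec_integral n M f + b) $ i"
    using i by (simp add: vec_integral_def)
qed (use b in \<open>simp add: vec_integral_def\<close>)

lemma gibbs_eq_tilt:
  "gibbs A B c w \<eta> \<nu> t = tilt \<nu> (\<lambda>\<pi>. \<eta> * (\<Sum>s\<in>{1..<t}. c s (cf_point A B c w s \<pi>)))"
  by (simp add: gibbs_def tilt_def gibbs_weight_def)

lemma cf_state_carrier:
  assumes A: "A \<in> carrier_mat dx dx" and B: "B \<in> carrier_mat dx du"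
    and w: "\<And>t. 1 \<le> t \<Longrightarrow> t \<le> T \<Longrightarrow> w t \<in> carrier_vec dx"
    and \<pi>: "causal_policy dx du \<pi>" and t: "t \<le> Suc T"
  shows "cf_state A B c w t \<pi> \<in> carrier_vec dx \<and> cf_action A B c w t \<pi> \<in> carrier_vec du"
proof -
  have act: "cf_action A B c w t \<pi> \<in> carrier_vec du"
    if "cf_state A B c w t \<pi> \<in> carrier_vec dx" "t \<le> Suc T" for t
  proof -
    \<comment> \<open>At round \<open>t\<close> only \<open>w 1\<close>, ...,
      \<open>w (t - 1)\<close> are revealed, so assumptions up to \<open>T\<close> reach round
      \<open>Suc T\<close>.\<close>
    have "set (revealed w t) \<subseteq> carrier_vec dx" "length (revealed c t) = length (revealed w t)"
      using w that(2) by (auto simp: revealed_def)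
    then show ?thesis
      using \<pi> that(1) unfolding causal_policy_def cf_action_def by blast
  qed
  have st: "cf_state A B c w t \<pi> \<in> carrier_vec dx"
    using t
  proof (induction t)
    case (Suc t)
    then show ?case
      using A B w[of t] act[of t] by (cases "t = 0") (auto simp flip: cf_action_def)
  qed (use A in simp)
  then show ?thesis using act t by simp
qed

section \<open>One run of Gibbs counterfactual tracking\<close>

text \<open>The condition on costs is stated for some set \<open>H\<close> containing the physical
  point and the essential range: the argument works from this inclusion, and the convex hull is one
  such \<open>H\<close>.\<close>

locale gibbs_tracking = prob_space \<nu> for \<nu> :: "policy measure" +
  fixes dx du T :: nat and A B K0 :: "real mat" and c :: "nat \<Rightarrow> cost" and w x u :: "nat \<Rightarrow> real vec"
    and \<eta> \<Delta> L :: real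
  assumes A: "A \<in> carrier_mat dx dx" and B: "B \<in> carrier_mat dx du" and K0: "K0 \<in> carrier_mat du dx"
    and w: "\<And>t. t \<in> {1..T} \<Longrightarrow> w t \<in> carrier_vec dx"
    and causal: "\<And>\<pi>. \<pi> \<in> space \<nu> \<Longrightarrow> causal_policy dx du \<pi>"
    and meas: "\<And>t. t \<in> {1..T} \<Longrightarrow> vec_measurable (dx + du) \<nu> (cf_point A B c w t)"
    and loss_meas: "\<And>t. t \<in> {1..T} \<Longrightarrow> (\<lambda>\<pi>. c t (cf_point A B c w t \<pi>)) \<in> borel_measurable \<nu>"
    and Lambda: "Lambda_finite A B K0"
    and \<eta>: "0 < \<eta>"
    and init: "x 1 = 0\<^sub>v dx" "x 1 - mean_state A B c w \<eta> \<nu> 1 = 0\<^sub>v dx"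
    and input: "\<And>t. t \<in> {1..T} \<Longrightarrow>
      u t = mean_action A B c w \<eta> \<nu> t - K0 *\<^sub>v (x t - mean_state A B c w \<eta> \<nu> t)"
    and step: "\<And>t. t \<in> {1..T} \<Longrightarrow> x (Suc t) = A *\<^sub>v x t + B *\<^sub>v u t + w t"
    and diam: "\<And>t \<pi> \<pi>'. t \<in> {1..T} \<Longrightarrow> \<pi> \<in> space \<nu> \<Longrightarrow> \<pi>' \<in> space \<nu> \<Longrightarrow>
      enorm (cf_point A B c w t \<pi> - cf_point A B c w t \<pi>') \<le> \<Delta>"
    and cost: "\<And>t. t \<in> {1..T} \<Longrightarrow> \<exists>H.
      insert (x t @\<^sub>v u t) (ess_range (dx + du) \<nu> (cf_point A B c w t)) \<subseteq> H \<and>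
      vec_convex_on H (c t) \<and> vec_lipschitz_on L H (c t)"
    and small: "\<eta> * L * \<Delta> \<le> 1/4"
begin

abbreviation Y where "Y \<equiv> cf_point A B c w"
abbreviation loss where "loss t \<pi> \<equiv> c t (Y t \<pi>)"
abbreviation P where "P \<equiv> gibbs A B c w \<eta> \<nu>"
abbreviation xm where "xm \<equiv> mean_state A B c w \<eta> \<nu>"
abbreviation um where "um \<equiv> mean_action A B c w \<eta> \<nu>"
abbreviation ym where "ym t \<equiv> xm t @\<^sub>v um t"
abbreviation AB where "AB \<equiv> four_block_mat A B (0\<^sub>m 0 (dim_col A)) (0\<^sub>m 0 (dim_col B))"

lemma state_carrier: "\<pi> \<in> space \<nu> \<Longrightarrow> t \<le> Suc T \<Longrightarrow> cf_state A B c w t \<pi> \<in> carrier_vec dx"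
  and action_carrier: "\<pi> \<in> space \<nu> \<Longrightarrow> t \<le> Suc T \<Longrightarrow> cf_action A B c w t \<pi> \<in> carrier_vec du"
  using cf_state_carrier[OF A B, where T = T and w = w and c = c and \<pi> = \<pi> and t = t] w causal by auto

lemma Y_carrier: "\<pi> \<in> space \<nu> \<Longrightarrow> t \<in> {1..T} \<Longrightarrow> Y t \<pi> \<in> carrier_vec (dx + du)"
  using state_carrier[of \<pi> t] action_carrier[of \<pi> t] by (simp add: cf_point_def append_carrier_vec)

lemma mean_carrier: "xm t \<in> carrier_vec dx" "um t \<in> carrier_vec du" "ym t \<in> carrier_vec (dx + du)"
proof -
  show "xm t \<in> carrier_vec dx" "um t \<in> carrier_vec du"
    using A B by (auto simp: mean_state_def mean_action_def vec_integral_def)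
  then show "ym t \<in> carrier_vec (dx + du)" by (rule append_carrier_vec)
qed

lemma x_carrier: "1 \<le> t \<Longrightarrow> t \<le> T \<Longrightarrow> x t \<in> carrier_vec dx \<and> u t \<in> carrier_vec du"
proof -
  have u: "u t \<in> carrier_vec du" if "x t \<in> carrier_vec dx" "t \<in> {1..T}" for t
    using that mean_carrier[of t] K0 by (auto simp: input[OF that(2)] intro!: minus_carrier_vec mult_mat_vec_carrier)
  have "x t \<in> carrier_vec dx" if "1 \<le> t" "t \<le> T"
    using that
  proof (induction t rule: nat_induct_at_least)
    case (Suc t)
    then show ?case using step[of t] u[of t] w[of t] A B by auto
  qed (use init(1) in simp)
  then show "1 \<le> t \<Longrightarrow> t \<le> T \<Longrightarrow> x t \<in> carrier_vec dx \<and> u t \<in> carrier_vec du"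
    using u by simp
qed

lemma Y_AE_ess_range: "t \<in> {1..T} \<Longrightarrow> AE \<pi> in \<nu>. Y t \<pi> \<in> ess_range (dx + du) \<nu> (Y t)"
  using AE_in_ess_range[OF meas[of t] Y_carrier[where t = t]] by simp

text \<open>The signs are read off from a round: \<open>\<Delta>\<close> bounds the distance of a
  counterfactual point from itself, and \<open>0 \<le> L\<close> is part of the Lipschitz
  condition.\<close>

lemma \<Delta>_L_nonneg: "t \<in> {1..T} \<Longrightarrow> 0 \<le> \<Delta> \<and> 0 \<le> L"
proof -
  assume t: "t \<in> {1..T}"
  obtain \<pi> where "\<pi> \<in> space \<nu>" using not_empty by blast
  then have "0 \<le> \<Delta>" using diam[OF t, of \<pi> \<pi>] order_trans[OF enorm_nonneg] by blast
  moreover have "0 \<le> L" using cost[OF t] by (auto simp: vec_lipschitz_on_def)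
  ultimately show ?thesis by simp
qed

text \<open>The constant is the loss of a reference policy. Its point has to lie in
  \<open>H\<close>, where the Lipschitz bound holds; such a policy exists because almost every point
  is in the essential range.\<close>

lemma loss_near: "t \<in> {1..T} \<Longrightarrow> \<exists>a. AE \<pi> in \<nu>. \<bar>loss t \<pi> - a\<bar> \<le> L * \<Delta>"
proof -
  assume t: "t \<in> {1..T}"
  obtain H where H: "ess_range (dx + du) \<nu> (Y t) \<subseteq> H" and lip: "vec_lipschitz_on L H (c t)"
    using cost[OF t] by auto
  have "\<exists>\<pi>\<in>space \<nu>. Y t \<pi> \<in> ess_range (dx + du) \<nu> (Y t)"
  proof (rule ccontr)
    assume "\<not> ?thesis"
    then have "AE \<pi> in \<nu>. False" using Y_AE_ess_range[OF t] by (auto elim!: AE_mp)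
    then show False by simp
  qed
  then obtain \<pi>0 where \<pi>0: "\<pi>0 \<in> space \<nu>" "Y t \<pi>0 \<in> H" using H by auto
  have "AE \<pi> in \<nu>. \<bar>loss t \<pi> - loss t \<pi>0\<bar> \<le> L * \<Delta>"
    using Y_AE_ess_range[OF t] AE_space
  proof eventually_elim
    case (elim \<pi>)
    have "\<bar>loss t \<pi> - loss t \<pi>0\<bar> \<le> L * enorm (Y t \<pi> - Y t \<pi>0)"
      using lip elim H \<pi>0 by (auto simp: vec_lipschitz_on_def)
    also have "\<dots> \<le> L * \<Delta>"
      using diam[OF t] elim \<pi>0 \<Delta>_L_nonneg[OF t] by (intro mult_left_mono) auto
    finally show ?case .
  qed
  then show ?thesis by blast
qed

lemma scaled_loss_near: "t \<in> {1..T} \<Longrightarrow> \<exists>a. AE \<pi> in \<nu>. \<bar>\<eta> * loss t \<pi> - a\<bar> \<le> \<eta> * L * \<Delta>"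
proof -
  assume "t \<in> {1..T}"
  then obtain a where "AE \<pi> in \<nu>. \<bar>loss t \<pi> - a\<bar> \<le> L * \<Delta>" using loss_near by blast
  then have "AE \<pi> in \<nu>. \<bar>\<eta> * loss t \<pi> - \<eta> * a\<bar> \<le> \<eta> * L * \<Delta>"
  proof eventually_elim
    case (elim \<pi>)
    have "\<bar>\<eta> * loss t \<pi> - \<eta> * a\<bar> = \<eta> * \<bar>loss t \<pi> - a\<bar>"
      using \<eta> by (simp add: abs_mult flip: right_diff_distrib)
    then show ?case using elim \<eta> by simp
  qed
  then show ?thesis by blast
qed

lemma loss_ess_bounded: "t \<in> {1..T} \<Longrightarrow> ess_bounded \<nu> (loss t)"
  using loss_near ess_bounded_near[OF loss_meas] by blast

lemma potential_ess_bounded: "t \<le> Suc T \<Longrightarrow> ess_bounded \<nu> (\<lambda>\<pi>. \<eta> * (\<Sum>s\<in>{1..<t}. loss s \<pi>))"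
  by (intro ess_bounded_cmult ess_bounded_sum loss_ess_bounded) auto

lemma prob_space_P: "t \<le> Suc T \<Longrightarrow> prob_space (P t)"
  unfolding gibbs_eq_tilt by (intro prob_space_tilt potential_ess_bounded)

lemma space_P [simp]: "space (P t) = space \<nu>" and sets_P [simp]: "sets (P t) = sets \<nu>"
  by (simp_all add: gibbs_eq_tilt)

lemma AE_P: "t \<le> Suc T \<Longrightarrow> AE \<pi> in \<nu>. Q \<pi> \<Longrightarrow> AE \<pi> in P t. Q \<pi>"
  unfolding gibbs_eq_tilt by (intro AE_tilt ess_boundedD[OF potential_ess_bounded])

lemma P_Suc: "t \<in> {1..T} \<Longrightarrow> P (Suc t) = tilt (P t) (\<lambda>\<pi>. \<eta> * loss t \<pi>)"
proof -
  assume t: "t \<in> {1..T}"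
  then have "{1..<Suc t} = insert t {1..<t}" by auto
  then have eq: "\<eta> * (\<Sum>s\<in>{1..<Suc t}. loss s \<pi>) = \<eta> * (\<Sum>s\<in>{1..<t}. loss s \<pi>) + \<eta> * loss t \<pi>" for \<pi>
    by (simp add: algebra_simps)
  then show ?thesis
    unfolding gibbs_eq_tilt eq using t
    by (intro tilt_tilt[symmetric] potential_ess_bounded ess_bounded_cmult loss_ess_bounded) auto
qed

lemma borel_measurable_P: "f \<in> borel_measurable (P t) \<longleftrightarrow> f \<in> borel_measurable \<nu>"
  by (intro arg_cong[where f = "\<lambda>S. f \<in> S"] measurable_cong_sets) auto

lemma vec_measurable_P: "t \<in> {1..T} \<Longrightarrow> vec_measurable (dx + du) (P s) (Y t)"
  using meas[of t] by (simp add: vec_measurable_def borel_measurable_P)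

text \<open>The index \<open>s\<close> of the law is independent of the round \<open>t\<close> of
  the point, because \<open>Y t\<close> is averaged under \<open>P t\<close> and also under
  \<open>P (Suc t)\<close>.\<close>

lemma Y_integrable:
  assumes t: "t \<in> {1..T}" and s: "s \<le> Suc T" and i: "i < dx + du"
  shows "integrable (P s) (\<lambda>\<pi>. Y t \<pi> $ i)"
proof -
  interpret P: prob_space "P s" by (rule prob_space_P[OF s])
  obtain \<pi>0 where \<pi>0: "\<pi>0 \<in> space \<nu>" using not_empty by blast
  show ?thesis
    by (rule P.integrable_ess_bounded, rule P.ess_bounded_index[where D = \<Delta> and z' = "Y t \<pi>0" and n = "dx + du"])
      (use Y_carrier \<pi>0 t i diam vec_measurable_P in auto)
qed

lemma mean_point: "t \<in> {1..T} \<Longrightarrow> vec_integral (dx + du) (P t) (Y t) = ym t"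
proof (rule eq_vecI)
  fix i assume t: "t \<in> {1..T}" and "i < dim_vec (ym t)"
  then have i: "i < dx + du" using mean_carrier[of t] by simp
  have "(\<integral>\<pi>. Y t \<pi> $ i \<partial>P t) =
      (\<integral>\<pi>. (if i < dx then cf_state A B c w t \<pi> $ i else cf_action A B c w t \<pi> $ (i - dx)) \<partial>P t)"
    using state_carrier[of _ t] action_carrier[of _ t] t i
    by (intro Bochner_Integration.integral_cong refl) (fastforce simp: cf_point_def)
  then show "vec_integral (dx + du) (P t) (Y t) $ i = ym t $ i"
    using i A B mean_carrier[of t]
    by (auto simp: vec_integral_def mean_state_def mean_action_def)
qed (use mean_carrier[of t] in \<open>simp add: vec_integral_def\<close>)

section \<open>Tracking error\<close>

lemma AB_carrier: "AB \<in> carrier_mat dx (dx + du)"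
  using four_block_carrier_mat[OF A, of "0\<^sub>m 0 du" 0 du B "0\<^sub>m 0 (dim_col A)"] A B by simp

lemma AB_mult:
  assumes "a \<in> carrier_vec dx" "b \<in> carrier_vec du"
  shows "AB *\<^sub>v (a @\<^sub>v b) = A *\<^sub>v a + B *\<^sub>v b"
proof -
  have "AB *\<^sub>v (a @\<^sub>v b) = (A *\<^sub>v a + B *\<^sub>v b) @\<^sub>v (0\<^sub>m 0 dx *\<^sub>v a + 0\<^sub>m 0 du *\<^sub>v b)"
    using A B assms by (simp add: four_block_mat_mult_vec[of A dx dx B du "0\<^sub>m 0 dx" 0 "0\<^sub>m 0 du"])
  also have "\<dots> = A *\<^sub>v a + B *\<^sub>v b"
    by (intro eq_vecI) auto
  finally show ?thesis .
qed

text \<open>The counterfactual dynamics are affine in the point and share the disturbance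
  \<open>w t\<close> among all policies, so they commute with averaging. The average of
  \<open>Y t\<close> is under \<open>P (Suc t)\<close>, not \<open>P t\<close>; this mismatch with
  \<open>ym t\<close> is the only source of tracking error.\<close>

lemma mean_state_Suc:
  assumes t: "t \<in> {1..T}"
  shows "xm (Suc t) = AB *\<^sub>v vec_integral (dx + du) (P (Suc t)) (Y t) + w t"
proof -
  interpret P: prob_space "P (Suc t)" by (rule prob_space_P) (use t in simp)
  have "cf_state A B c w (Suc t) \<pi> = AB *\<^sub>v Y t \<pi> + w t" if \<pi>: "\<pi> \<in> space \<nu>" for \<pi>
    using t state_carrier[OF \<pi>, of t] action_carrier[OF \<pi>, of t]
    by (simp add: cf_point_def AB_mult flip: cf_action_def)
  then have "xm (Suc t) = vec_integral dx (P (Suc t)) (\<lambda>\<pi>. AB *\<^sub>v Y t \<pi> + w t)"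
    using A unfolding mean_state_def vec_integral_def
    by (intro eq_vecI) (auto intro!: Bochner_Integration.integral_cong)
  also have "\<dots> = AB *\<^sub>v vec_integral (dx + du) (P (Suc t)) (Y t) + w t"
    using t by (intro P.vec_integral_affine AB_carrier w Y_integrable Y_carrier) auto
  finally show ?thesis .
qed

lemma tracking_gap:
  assumes t: "t \<in> {1..T}"
  shows "enorm ((x t @\<^sub>v u t) - ym t) \<le> Lambda A B K0 * (B_plus A B * (4 * (\<eta> * L * \<Delta>) * \<Delta>))"
proof -
  define e where "e s = x s - xm s" for s
  \<comment> \<open>The displacement of the mean point caused by updating \<open>P s\<close> to
    \<open>P (Suc s)\<close>, pushed through the dynamics.\<close>
  define d where "d s = AB *\<^sub>v (ym s - vec_integral (dx + du) (P (Suc s)) (Y s))" for s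
  define \<delta> where "\<delta> = B_plus A B * (4 * (\<eta> * L * \<Delta>) * \<Delta>)"
  have e_carrier: "e s \<in> carrier_vec dx" if "1 \<le> s" "s \<le> T" for s
    using x_carrier[OF that] mean_carrier[of s] by (simp add: e_def)
  have nn: "0 \<le> \<Delta>" "0 \<le> L" using \<Delta>_L_nonneg[OF t] by auto
  have diff_c: "ym s - vec_integral (dx + du) (P (Suc s)) (Y s) \<in> carrier_vec (dx + du)" for s
    by (rule minus_carrier_vec[OF mean_carrier(3)]) (simp add: vec_integral_def)
  have d: "d s \<in> carrier_vec dx \<and> enorm (d s) \<le> \<delta>" if s: "1 \<le> s" "s < T" for s
  proof
    show "d s \<in> carrier_vec dx"
      unfolding d_def using AB_carrier diff_c by (rule mult_mat_vec_carrier)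
    have s': "s \<in> {1..T}" using s by simp
    interpret P: prob_space "P s" by (rule prob_space_P) (use s in simp)
    obtain a where a: "AE \<pi> in \<nu>. \<bar>\<eta> * loss s \<pi> - a\<bar> \<le> \<eta> * L * \<Delta>"
      using scaled_loss_near[OF s'] by blast
    obtain \<pi>0 where \<pi>0: "\<pi>0 \<in> space \<nu>" using not_empty by blast
    have "enorm (vec_integral (dx + du) (P s) (Y s) -
        vec_integral (dx + du) (tilt (P s) (\<lambda>\<pi>. \<eta> * loss s \<pi>)) (Y s)) \<le> 4 * (\<eta> * L * \<Delta>) * \<Delta>"
    proof (rule P.enorm_vec_integral_tilt)
      show "(\<lambda>\<pi>. \<eta> * loss s \<pi>) \<in> borel_measurable (P s)"
        unfolding borel_measurable_P using loss_meas[OF s'] by simp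
      show "AE \<pi> in P s. \<bar>\<eta> * loss s \<pi> - a\<bar> \<le> \<eta> * L * \<Delta>" by (rule AE_P) (use s a in auto)
      show "enorm (Y s \<pi> - Y s \<pi>0) \<le> \<Delta>" if "\<pi> \<in> space (P s)" for \<pi>
        using diam[OF s'] \<pi>0 that by simp
    qed (use nn \<eta> small s' \<pi>0 Y_carrier vec_measurable_P in auto)
    then have le: "enorm (ym s - vec_integral (dx + du) (P (Suc s)) (Y s)) \<le> 4 * (\<eta> * L * \<Delta>) * \<Delta>"
      unfolding mean_point[OF s'] P_Suc[OF s'] .
    have "enorm (d s) \<le> opnorm AB * enorm (ym s - vec_integral (dx + du) (P (Suc s)) (Y s))"
      unfolding d_def using AB_carrier diff_c by (intro enorm_mult_mat_vec) (metis carrier_matD(2))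
    also have "\<dots> \<le> \<delta>"
      unfolding \<delta>_def B_plus_def using le by (intro mult_left_mono opnorm_nonneg)
    finally show "enorm (d s) \<le> \<delta>" .
  qed
  have rec: "e (Suc s) = (A - B * K0) *\<^sub>v e s + d s" if s: "1 \<le> s" "s < T" for s
  proof -
    let ?m = "vec_integral (dx + du) (P (Suc s)) (Y s)"
    have s': "s \<in> {1..T}" using s by simp
    have es: "e s \<in> carrier_vec dx" using e_carrier s by simp
    have mc: "?m \<in> carrier_vec (dx + du)" by (simp add: vec_integral_def)
    have xs: "x s \<in> carrier_vec dx" using x_carrier s by simp
    have ws: "w s \<in> carrier_vec dx" using w[OF s'] .
    note carr = es mc xs ws mean_carrier[of s] A B K0 AB_carrier
    have Ke: "K0 *\<^sub>v e s \<in> carrier_vec du" using K0 es by (rule mult_mat_vec_carrier)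
    have X: "x (Suc s) = A *\<^sub>v x s + (B *\<^sub>v um s - B *\<^sub>v (K0 *\<^sub>v e s)) + w s"
      unfolding step[OF s'] input[OF s'] e_def[symmetric]
      using mult_minus_distrib_mat_vec[OF B mean_carrier(2) Ke] by simp
    have XM: "xm (Suc s) = AB *\<^sub>v ?m + w s" by (rule mean_state_Suc[OF s'])
    have D: "d s = (A *\<^sub>v xm s + B *\<^sub>v um s) - AB *\<^sub>v ?m"
      unfolding d_def mult_minus_distrib_mat_vec[OF AB_carrier mean_carrier(3) mc]
      by (simp add: AB_mult mean_carrier)
    have Fe: "(A - B * K0) *\<^sub>v e s = (A *\<^sub>v x s - A *\<^sub>v xm s) - B *\<^sub>v (K0 *\<^sub>v e s)"
      using minus_mult_distrib_mat_vec[OF A mult_carrier_mat[OF B K0] es]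
        assoc_mult_mat_vec[OF B K0 es] mult_minus_distrib_mat_vec[OF A xs mean_carrier(1)[of s]]
      by (simp add: e_def)
    have mv: "A *\<^sub>v x s \<in> carrier_vec dx" "A *\<^sub>v xm s \<in> carrier_vec dx"
      "B *\<^sub>v um s \<in> carrier_vec dx" "B *\<^sub>v (K0 *\<^sub>v e s) \<in> carrier_vec dx" "AB *\<^sub>v ?m \<in> carrier_vec dx"
      using carr Ke by (auto intro: mult_mat_vec_carrier)
    \<comment> \<open>Here \<open>v\<close> stands for the disturbance, common to the physical and
      the mean state, and \<open>p\<close> for \<open>A\<close> applied to the mean state, which is
      subtracted and added back to separate the feedback part from \<open>d s\<close>.\<close>
    have alg: "(a + (b - k) + v) - (m + v) = (a - p - k) + ((p + b) - m)"
      if "a \<in> carrier_vec dx" "p \<in> carrier_vec dx" "b \<in> carrier_vec dx" "k \<in> carrier_vec dx"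
        "m \<in> carrier_vec dx" "v \<in> carrier_vec dx" for a b k m p v :: "real vec"
      using that by (intro eq_vecI) auto
    show ?thesis
      unfolding e_def[of "Suc s"] X XM D Fe by (rule alg[OF mv ws])
  qed
  have \<delta>: "0 \<le> \<delta>" unfolding \<delta>_def B_plus_def using nn \<eta> by (intro mult_nonneg_nonneg opnorm_nonneg) auto
  have et: "e t \<in> carrier_vec dx" using e_carrier t by simp
  \<comment> \<open>The control law makes the action error \<open>- K0\<close> times the state
    error, so the whole error is block 0 applied to \<open>e t\<close>. The case
    \<open>r = 0\<close> of the unrolled bound is then a partial sum of
    \<open>Lambda\<close>.\<close>
  have "(x t @\<^sub>v u t) - ym t = e t @\<^sub>v (- K0 *\<^sub>v e t)"
  proof (rule eq_vecI)
    show "dim_vec ((x t @\<^sub>v u t) - ym t) = dim_vec (e t @\<^sub>v (- K0 *\<^sub>v e t))"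
      using x_carrier[of t] t mean_carrier[of t] K0 et by auto
    fix i assume "i < dim_vec (e t @\<^sub>v (- K0 *\<^sub>v e t))"
    then show "((x t @\<^sub>v u t) - ym t) $ i = (e t @\<^sub>v (- K0 *\<^sub>v e t)) $ i"
      using x_carrier[of t] t mean_carrier[of t] K0 et input[OF t] by (auto simp: e_def)
  qed
  also have "\<dots> = tracking_block A B K0 0 *\<^sub>v e t"
    using A B K0 et mat_mult_append[of "1\<^sub>m dx" dx dx "- K0" du "e t"]
    by (simp add: tracking_block_def minus_carrier_mat right_mult_one_mat[of _ "dx + du"])
  finally have "enorm ((x t @\<^sub>v u t) - ym t) = enorm (tracking_block A B K0 0 *\<^sub>v e t)" by simp
  also have "\<dots> \<le> (\<Sum>j<t - 1. opnorm (tracking_block A B K0 (0 + j))) * \<delta>"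
    using enorm_tracking_block[OF A B K0, of e T d \<delta> t 0] init(2) rec d t by (simp add: e_def)
  also have "\<dots> \<le> Lambda A B K0 * \<delta>"
    unfolding Lambda_def using Lambda \<delta>
    by (intro mult_right_mono) (auto simp: Lambda_finite_def intro!: sum_le_suminf opnorm_nonneg)
  finally show ?thesis unfolding \<delta>_def .
qed

section \<open>Partition functions and regret\<close>

definition Z :: "nat \<Rightarrow> real" where
  "Z t = (\<integral>\<pi>. exp (- (\<eta> * (\<Sum>s\<in>{1..<t}. loss s \<pi>))) \<partial>\<nu>)"

lemma Z_pos: "t \<le> Suc T \<Longrightarrow> 0 < Z t"
  unfolding Z_def by (intro integral_exp_minus_pos potential_ess_bounded)

text \<open>The density of \<open>P t\<close> carries the past losses and the factor
  \<open>1 / Z t\<close>, so the normaliser of one update is a ratio of consecutive partition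
  functions. This is what makes the logarithms telescope.\<close>

lemma Z_Suc:
  assumes t: "t \<in> {1..T}"
  shows "(\<integral>\<pi>. exp (- (\<eta> * loss t \<pi>)) \<partial>P t) = Z (Suc t) / Z t"
proof -
  have "(\<lambda>\<pi>. exp (- (\<eta> * loss t \<pi>))) \<in> borel_measurable \<nu>"
    by (intro ess_boundedD[OF ess_bounded_exp_minus] ess_bounded_cmult loss_ess_bounded t)
  then have "(\<integral>\<pi>. exp (- (\<eta> * loss t \<pi>)) \<partial>P t) =
      (\<integral>\<pi>. exp (- (\<eta> * (\<Sum>s\<in>{1..<t}. loss s \<pi>))) / Z t * exp (- (\<eta> * loss t \<pi>)) \<partial>\<nu>)"
    using t unfolding gibbs_eq_tilt Z_def by (intro integral_tilt potential_ess_bounded) auto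
  also have "\<dots> = (\<integral>\<pi>. exp (- (\<eta> * (\<Sum>s\<in>{1..<Suc t}. loss s \<pi>))) / Z t \<partial>\<nu>)"
    by (intro Bochner_Integration.integral_cong refl) (use t in \<open>simp add: mult_exp_exp algebra_simps\<close>)
  finally show ?thesis by (simp add: Z_def)
qed

lemma round_bound:
  assumes t: "t \<in> {1..T}"
  shows "\<eta> * c t (x t @\<^sub>v u t) \<le> ln (Z t) - ln (Z (Suc t)) + 4 * (\<eta> * L * \<Delta>)\<^sup>2 * Gamma_tr A B K0"
proof -
  interpret P: prob_space "P t" by (rule prob_space_P) (use t in simp)
  obtain H where H: "insert (x t @\<^sub>v u t) (ess_range (dx + du) \<nu> (Y t)) \<subseteq> H"
    and conv: "vec_convex_on H (c t)" and lip: "vec_lipschitz_on L H (c t)"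
    using cost[OF t] by blast
  obtain \<pi>0 where \<pi>0: "\<pi>0 \<in> space \<nu>" using not_empty by blast
  have nn: "0 \<le> \<Delta>" "0 \<le> L" using \<Delta>_L_nonneg[OF t] by auto
  have "AE \<pi> in \<nu>. Y t \<pi> \<in> H"
    using Y_AE_ess_range[OF t] by eventually_elim (use H in auto)
  then have H_AE: "AE \<pi> in P t. Y t \<pi> \<in> H" by (intro AE_P) (use t in auto)
  obtain b where "AE \<pi> in \<nu>. \<bar>loss t \<pi>\<bar> \<le> b" using loss_ess_bounded[OF t] by (auto simp: ess_bounded_def)
  then have "AE \<pi> in P t. \<bar>loss t \<pi>\<bar> \<le> b" by (intro AE_P) (use t in auto)
  then have "ess_bounded (P t) (loss t)"
    using loss_meas[OF t] by (auto simp: ess_bounded_def borel_measurable_P)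
  then have int: "integrable (P t) (loss t)" by (rule P.integrable_ess_bounded)
  have gap: "enorm ((x t @\<^sub>v u t) - ym t) \<le> Lambda A B K0 * (B_plus A B * (4 * (\<eta> * L * \<Delta>) * \<Delta>))"
    by (rule tracking_gap[OF t])
  have yc: "x t @\<^sub>v u t \<in> carrier_vec (dx + du)" using x_carrier[of t] t by (auto intro: append_carrier_vec)
  have "c t (x t @\<^sub>v u t) \<le> (\<integral>\<pi>. loss t \<pi> \<partial>P t) + L * enorm ((x t @\<^sub>v u t) - vec_integral (dx + du) (P t) (Y t))"
  proof (rule P.jensen_lipschitz[OF conv lip])
    show "enorm (Y t \<pi> - Y t \<pi>0) \<le> \<Delta>" if "\<pi> \<in> space (P t)" for \<pi> using diam[OF t] \<pi>0 that by simp
  qed (use H yc H_AE int t Y_carrier vec_measurable_P \<pi>0 in auto)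
  also have "\<dots> \<le> (\<integral>\<pi>. loss t \<pi> \<partial>P t) + L * (Lambda A B K0 * (B_plus A B * (4 * (\<eta> * L * \<Delta>) * \<Delta>)))"
    unfolding mean_point[OF t] using gap nn by (simp add: mult_left_mono)
  finally have "\<eta> * c t (x t @\<^sub>v u t) \<le>
      \<eta> * ((\<integral>\<pi>. loss t \<pi> \<partial>P t) + L * (Lambda A B K0 * (B_plus A B * (4 * (\<eta> * L * \<Delta>) * \<Delta>))))"
    using \<eta> by simp
  also have "\<dots> = (\<integral>\<pi>. \<eta> * loss t \<pi> \<partial>P t) + 4 * (\<eta> * L * \<Delta>)\<^sup>2 * (Lambda A B K0 * B_plus A B)"
    by (simp add: algebra_simps power2_eq_square)
  finally have 1: "\<eta> * c t (x t @\<^sub>v u t) \<le>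
      (\<integral>\<pi>. \<eta> * loss t \<pi> \<partial>P t) + 4 * (\<eta> * L * \<Delta>)\<^sup>2 * (Lambda A B K0 * B_plus A B)" .
  obtain a where a: "AE \<pi> in \<nu>. \<bar>\<eta> * loss t \<pi> - a\<bar> \<le> \<eta> * L * \<Delta>"
    using scaled_loss_near[OF t] by blast
  have "(\<integral>\<pi>. \<eta> * loss t \<pi> \<partial>P t) \<le> - ln (\<integral>\<pi>. exp (- (\<eta> * loss t \<pi>)) \<partial>P t) + 2 * (\<eta> * L * \<Delta>)\<^sup>2"
  proof (rule P.expectation_le_log_partition)
    show "(\<lambda>\<pi>. \<eta> * loss t \<pi>) \<in> borel_measurable (P t)"
      unfolding borel_measurable_P using loss_meas[OF t] by simp
    show "AE \<pi> in P t. \<bar>\<eta> * loss t \<pi> - a\<bar> \<le> \<eta> * L * \<Delta>" by (rule AE_P) (use t a in auto)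
  qed (rule small)
  also have "\<dots> = ln (Z t) - ln (Z (Suc t)) + 2 * (\<eta> * L * \<Delta>)\<^sup>2"
    using Z_pos[of t] Z_pos[of "Suc t"] t by (simp add: Z_Suc ln_div)
  \<comment> \<open>The constant 2 is relaxed to 4 to match the tracking term, so that the two add
    up to a multiple of \<open>1 + \<Lambda>(K\<^sub>0) B\<^sub>+\<close>.\<close>
  finally have 2: "(\<integral>\<pi>. \<eta> * loss t \<pi> \<partial>P t) \<le> ln (Z t) - ln (Z (Suc t)) + 4 * (\<eta> * L * \<Delta>)\<^sup>2"
    by (smt (verit) zero_le_power2)
  show ?thesis using 1 2 by (simp add: Gamma_tr_def algebra_simps)
qed

lemma regret_bound:
  assumes \<rho>: "prob_space \<rho>" "sets \<rho> = sets \<nu>" "absolutely_continuous \<nu> \<rho>"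
  shows "ereal ((\<Sum>t=1..T. c t (x t @\<^sub>v u t)) - (\<integral>\<pi>. (\<Sum>t=1..T. loss t \<pi>) \<partial>\<rho>))
    \<le> relative_entropy \<rho> \<nu> / ereal \<eta> + ereal (4 * \<eta> * L\<^sup>2 * \<Delta>\<^sup>2 * Gamma_tr A B K0 * real T)"
proof (cases "integrable \<rho> (entropy_density (exp 1) \<nu> \<rho>)")
  case False
  \<comment> \<open>The relative entropy is infinite here, hence so is the right-hand side.\<close>
  then show ?thesis using \<eta> by (simp add: relative_entropy_def)
next
  case True
  let ?F = "\<lambda>\<pi>. \<Sum>t=1..T. loss t \<pi>"
  let ?S = "\<Sum>t=1..T. c t (x t @\<^sub>v u t)"
  let ?KL = "KL_divergence (exp 1) \<nu> \<rho>"
  have "\<eta> * ?S \<le> (\<Sum>t=1..T. (ln (Z t) - ln (Z (Suc t))) + 4 * (\<eta> * L * \<Delta>)\<^sup>2 * Gamma_tr A B K0)"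
    unfolding sum_distrib_left by (intro sum_mono round_bound)
  also have "\<dots> = (\<Sum>t=1..T. ln (Z t) - ln (Z (Suc t))) + real T * (4 * (\<eta> * L * \<Delta>)\<^sup>2 * Gamma_tr A B K0)"
    by (simp add: sum.distrib)
  also have "(\<Sum>t=1..T. ln (Z t) - ln (Z (Suc t))) = ln (Z 1) - ln (Z (Suc T))"
    using sum_Suc_diff[of 1 "Suc T" "\<lambda>t. - ln (Z t)"] by (simp add: atLeastLessThanSuc_atLeastAtMost)
  \<comment> \<open>No loss precedes round 1, so the exponent is an empty sum and
    \<open>\<nu>\<close> has mass 1.\<close>
  also have "Z 1 = 1" by (simp add: Z_def prob_space)
  finally have 1: "\<eta> * ?S \<le> - ln (Z (Suc T)) + real T * (4 * (\<eta> * L * \<Delta>)\<^sup>2 * Gamma_tr A B K0)" by simp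
  \<comment> \<open>Donsker--Varadhan with \<open>h\<close> equal to \<open>\<eta>\<close> times the
    total loss over all \<open>T\<close> rounds; the index \<open>Suc T\<close> is what includes
    round \<open>T\<close>.\<close>
  have "- ln (Z (Suc T)) \<le> (\<integral>\<pi>. \<eta> * ?F \<pi> \<partial>\<rho>) + ?KL"
    using log_partition_le_KL[OF potential_ess_bounded[OF order_refl] \<rho> True]
    by (simp add: Z_def atLeastLessThanSuc_atLeastAtMost)
  then have "\<eta> * (?S - (\<integral>\<pi>. ?F \<pi> \<partial>\<rho>)) \<le> ?KL + real T * (4 * (\<eta> * L * \<Delta>)\<^sup>2 * Gamma_tr A B K0)"
    using 1 by (simp add: right_diff_distrib)
  also have "\<dots> = \<eta> * (?KL / \<eta> + 4 * \<eta> * L\<^sup>2 * \<Delta>\<^sup>2 * Gamma_tr A B K0 * real T)"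
    using \<eta> by (simp add: power2_eq_square field_simps)
  finally have "?S - (\<integral>\<pi>. ?F \<pi> \<partial>\<rho>) \<le> ?KL / \<eta> + 4 * \<eta> * L\<^sup>2 * \<Delta>\<^sup>2 * Gamma_tr A B K0 * real T"
    using \<eta> by simp
  then show ?thesis using \<eta> True \<rho>(3) by (simp add: relative_entropy_def)
qed

end

theorem theorem4p1:
  "\<exists>c0 > (0::real). \<exists>C > (0::real).
    \<forall>(dx::nat) (du::nat) (A::real mat) (B::real mat) (K0::real mat) (W::real) (T::nat)
      (c::nat \<Rightarrow> cost) (w::nat \<Rightarrow> real vec) (x::nat \<Rightarrow> real vec) (u::nat \<Rightarrow> real vec)
      (\<nu>::policy measure) (\<eta>::real) (\<Delta>::real) (L::real).
      A \<in> carrier_mat dx dx \<longrightarrow> B \<in> carrier_mat dx du \<longrightarrow> K0 \<in> carrier_mat du dx \<longrightarrow>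
      (\<forall>t\<in>{1..T}. w t \<in> carrier_vec dx \<and> enorm (w t) \<le> W) \<longrightarrow>
      prob_space \<nu> \<longrightarrow> standard_borel_space \<nu> \<longrightarrow>
      (\<forall>\<pi>\<in>space \<nu>. causal_policy dx du \<pi>) \<longrightarrow>
      (\<forall>t\<in>{1..T}. vec_measurable (dx + du) \<nu> (cf_point A B c w t)) \<longrightarrow>
      (\<forall>t\<in>{1..T}. (\<lambda>\<pi>. c t (cf_point A B c w t \<pi>)) \<in> borel_measurable \<nu>) \<longrightarrow>
      (\<forall>t\<in>{1..T}. vec_integrable (dx + du) (gibbs A B c w \<eta> \<nu> t) (cf_point A B c w t)) \<longrightarrow>
      Lambda_finite A B K0 \<longrightarrow>
      0 < \<eta> \<longrightarrow>
      x 1 = 0\<^sub>v dx \<longrightarrow> x 1 - mean_state A B c w \<eta> \<nu> 1 = 0\<^sub>v dx \<longrightarrow>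
      (\<forall>t\<in>{1..T}. u t = mean_action A B c w \<eta> \<nu> t - K0 *\<^sub>v (x t - mean_state A B c w \<eta> \<nu> t)) \<longrightarrow>
      (\<forall>t\<in>{1..T}. x (Suc t) = A *\<^sub>v x t + B *\<^sub>v u t + w t) \<longrightarrow>
      (\<forall>t\<in>{1..T}. \<forall>\<pi>\<in>space \<nu>. \<forall>\<pi>'\<in>space \<nu>.
         enorm (cf_point A B c w t \<pi> - cf_point A B c w t \<pi>') \<le> \<Delta>) \<longrightarrow>
      (\<forall>t\<in>{1..T}.
         let H = vec_convex_hull (insert (x t @\<^sub>v u t) (ess_range (dx + du) \<nu> (cf_point A B c w t)))
         in vec_convex_on H (c t) \<and> vec_lipschitz_on L H (c t)) \<longrightarrow>
      \<eta> * L * \<Delta> \<le> c0 \<longrightarrow>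
      (\<forall>\<rho>. prob_space \<rho> \<longrightarrow> sets \<rho> = sets \<nu> \<longrightarrow> absolutely_continuous \<nu> \<rho> \<longrightarrow>
         ereal ((\<Sum>t=1..T. c t (x t @\<^sub>v u t)) - (\<integral>\<pi>. (\<Sum>t=1..T. c t (cf_point A B c w t \<pi>)) \<partial>\<rho>))
           \<le> relative_entropy \<rho> \<nu> / ereal \<eta>
             + ereal (C * \<eta> * L\<^sup>2 * \<Delta>\<^sup>2 * Gamma_tr A B K0 * real T))"
proof (rule exI[of _ "1/4"], intro conjI, simp, rule exI[of _ 4], intro conjI, simp, intro allI impI, goal_cases)
  case prems: (1 dx du A B K0 W T c w x u \<nu> \<eta> \<Delta> L \<rho>)
  interpret \<nu>: prob_space \<nu> by (rule prems)
  interpret gibbs_tracking \<nu> dx du T A B K0 c w x u \<eta> \<Delta> L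
  proof
    fix t assume t: "t \<in> {1..T}"
    let ?S = "insert (x t @\<^sub>v u t) (ess_range (dx + du) \<nu> (cf_point A B c w t))"
    show "\<exists>H. ?S \<subseteq> H \<and> vec_convex_on H (c t) \<and> vec_lipschitz_on L H (c t)"
      using prems(18) t hull_subset[of ?S vec_convex]
      by (intro exI[of _ "vec_convex_hull ?S"]) (auto simp: vec_convex_hull_def Let_def)
  qed (use prems in auto)
  show ?case by (rule regret_bound) (use prems in auto)
qed

end
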